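(* Let $f(x)=\mathbb{E}_\xi[\ell(x;\xi)]$ be a real-valued function on $\mathbb{R}^d$, let $h:\mathbb{R}^d\to\mathbb{R}\cup\{+\infty\}$ be convex, proper and lower semicontinuous, and let $F=f+h$ be bounded from below. Let $\gamma,\eta>0$ and positive integer batch sizes $\{b_k\}_{k\ge1}$ be arbitrary, and let $\{x_k\}_{k\ge1}$, $\{S_k\}_{k\ge1}$ be generated by the stochastic adaptive proximal gradient method described in the context, started at $x_1\in\mathrm{dom}(h)$. Suppose that the bounded-iterates assumption with constant $D>0$ and the unbiasedness and bounded-variance assumption with constant $\sigma>0$ stated in the context hold. Let $\delta_k:=\nabla f(x_k)-g_k$. Then for every $t\ge1$, $$\mathbb{E}\Big[\sum_{k=1}^t\langle\delta_k,x_{k+1}-x_k\rangle\Big]\le\sigma\sqrt{2(\eta^2+D^2)\sum_{k=1}^t\frac1{b_k}}\;\sqrt{\log\mathbb{E}\Big[\frac{S_{t+1}}{\gamma}\Big]}.$$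
   Context: $\|\cdot\|$ is the Euclidean norm and $\log$ the natural logarithm. $\mathrm{dom}(h):=\{x:h(x)<+\infty\}$. The function $f$ is either differentiable with gradient $\nabla f$, or convex, in which case $\nabla f(x)$ denotes a subgradient of $f$ at $x$; no further condition on $f$ is imposed. Stochastic adaptive proximal gradient method: set $S_1:=\gamma$. For $k=1,2,\dots$: draw independent samples $\xi_{k_1},\dots,\xi_{k_{b_k}}$ (independent of the past) from the data distribution; set $g_k:=\frac1{b_k}\sum_{j=1}^{b_k}\nabla\ell(x_k;\xi_{k_j})$; $$x_{k+1}:=\operatorname*{arg\,min}_{x\in\mathbb{R}^d}\Big\{\langle g_k,x\rangle+\frac{S_k}{2\eta}\|x-x_k\|^2+h(x)\Big\},\qquad S_{k+1}^2:=S_k^2\Big(1+\frac{\|x_{k+1}-x_k\|^2}{\eta^2}\Big),\ S_{k+1}>0.$$ Let $\mathbb{E}_k[\cdot]$ denote conditional expectation given all samples used before iteration $k$. Bounded-iterates assumption: $\|x_{k+1}-x_k\|\le D$ for all $k\ge1$; moreover, if $F$ is convex, it is assumed to have a global minimizer $x^*$ and $\|x_k-x^*\|\le D$ for all $k\ge1$. Unbiasedness and bounded variance: for all $k\ge1$, $\mathbb{E}_k[\nabla\ell(x_k;\xi)]=\nabla f(x_k)$ and $\mathbb{E}_k[\|\nabla\ell(x_k;\xi)-\nabla f(x_k)\|^2]\le\sigma^2$, where $\xi$ is a sample drawn at iteration $k$. *)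

theory Defs
  imports "HOL-Probability.Probability"
begin

text \<open>Extended-valued functions of type \<^typ>\<open>'a \<Rightarrow> ereal\<close>. The convexity inequality below is the
  usual one as long as the function never takes the value \<^term>\<open>-\<infinity>\<close>; at the end points of the
  segment it relies on \<open>0 * \<infinity> = 0\<close>.\<close>

definition proper_ereal :: "('a \<Rightarrow> ereal) \<Rightarrow> bool" where
  "proper_ereal h \<longleftrightarrow> (\<forall>y. h y \<noteq> -\<infinity>) \<and> (\<exists>y. h y \<noteq> \<infinity>)"

definition convex_ereal :: "('a::real_vector \<Rightarrow> ereal) \<Rightarrow> bool" where
  "convex_ereal h \<longleftrightarrow>
    (\<forall>y u t. 0 \<le> t \<and> t \<le> 1 \<longrightarrow>
      h ((1 - t) *\<^sub>R y + t *\<^sub>R u) \<le> ereal (1 - t) * h y + ereal t * h u)"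

definition lsc_ereal :: "('a::topological_space \<Rightarrow> ereal) \<Rightarrow> bool" where
  "lsc_ereal h \<longleftrightarrow> (\<forall>y. h y \<le> Liminf (at y) h)"

definition is_subgradient :: "('a::real_inner \<Rightarrow> real) \<Rightarrow> 'a \<Rightarrow> 'a \<Rightarrow> bool" where
  "is_subgradient f y v \<longleftrightarrow> (\<forall>u. f u \<ge> f y + v \<bullet> (u - y))"

text \<open>The convention for the symbol \<open>\<nabla>f\<close>: the gradient of a differentiable function, or an arbitrary
  selection of subgradients of a convex one.\<close>

definition is_gradient_field :: "('a::real_inner \<Rightarrow> real) \<Rightarrow> ('a \<Rightarrow> 'a) \<Rightarrow> bool" where
  "is_gradient_field f gf \<longleftrightarrow>
    (\<forall>y. GDERIV f y :> gf y) \<or> (convex_on UNIV f \<and> (\<forall>y. is_subgradient f y (gf y)))"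

text \<open>The convention for \<open>\<nabla>l(y; z)\<close>. The functions \<open>l(\<cdot>; z)\<close> need not be differentiable everywhere or
  convex, even if their expectation is. Hence \<open>gl y z\<close> is tied to \<open>l\<close> only where a gradient or a
  subgradient has a meaning, and is otherwise constrained by unbiasedness alone.\<close>

definition is_sample_gradient ::
  "'z set \<Rightarrow> ('a::real_inner \<Rightarrow> 'z \<Rightarrow> real) \<Rightarrow> ('a \<Rightarrow> 'z \<Rightarrow> 'a) \<Rightarrow> bool" where
  "is_sample_gradient Z l gl \<longleftrightarrow>
    (\<forall>z\<in>Z.
      (\<forall>y v. (GDERIV (\<lambda>u. l u z) y :> v) \<longrightarrow> gl y z = v) \<and>
      (convex_on UNIV (\<lambda>u. l u z) \<longrightarrow> (\<forall>y. is_subgradient (\<lambda>u. l u z) y (gl y z))))"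

definition minibatch_gradient ::
  "('a::real_vector \<Rightarrow> 'z \<Rightarrow> 'a) \<Rightarrow> nat \<Rightarrow> 'a \<Rightarrow> (nat \<Rightarrow> 'z) \<Rightarrow> 'a" where
  "minibatch_gradient gl n y z = (1 / real n) *\<^sub>R (\<Sum>j = 1..n. gl y (z j))"

text \<open>One trajectory: \<open>z k j\<close> is the \<open>j\<close>-th sample of iteration \<open>k\<close>. Iterations are numbered from 1,
  so \<open>x 0\<close> and \<open>S 0\<close> are irrelevant.\<close>

definition adaptive_prox_gradient_run ::
  "('a::real_inner \<Rightarrow> ereal) \<Rightarrow> ('a \<Rightarrow> 'z \<Rightarrow> 'a) \<Rightarrow> (nat \<Rightarrow> nat) \<Rightarrow> real \<Rightarrow> real \<Rightarrow> 'a \<Rightarrow>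
    (nat \<Rightarrow> nat \<Rightarrow> 'z) \<Rightarrow> (nat \<Rightarrow> 'a) \<Rightarrow> (nat \<Rightarrow> real) \<Rightarrow> bool" where
  "adaptive_prox_gradient_run h gl b \<gamma> \<eta> x1 z x S \<longleftrightarrow>
    x 1 = x1 \<and> S 1 = \<gamma> \<and>
    (\<forall>k\<ge>1.
      is_arg_min
        (\<lambda>u. ereal (minibatch_gradient gl (b k) (x k) (z k) \<bullet> u
                      + S k / (2 * \<eta>) * (norm (u - x k))\<^sup>2) + h u)
        (\<lambda>_. True) (x (Suc k)) \<and>
      S (Suc k) > 0 \<and>
      (S (Suc k))\<^sup>2 = (S k)\<^sup>2 * (1 + (norm (x (Suc k) - x k))\<^sup>2 / \<eta>\<^sup>2))"

text \<open>The \<open>\<sigma>\<close>-algebra generated by the samples used before iteration \<open>k\<close>. It is generated explicitly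
  by preimages, so that for \<open>k = 1\<close> it is the trivial \<open>\<sigma>\<close>-algebra on \<^term>\<open>space M\<close>.\<close>

definition past_samples ::
  "'o measure \<Rightarrow> 'z measure \<Rightarrow> (nat \<Rightarrow> nat) \<Rightarrow> (nat \<Rightarrow> nat \<Rightarrow> 'o \<Rightarrow> 'z) \<Rightarrow> nat \<Rightarrow> 'o measure" where
  "past_samples M P b \<xi> k =
    sigma (space M)
      {\<xi> i j -` A \<inter> space M | i j A. i \<in> {1..<k} \<and> j \<in> {1..b i} \<and> A \<in> sets P}"

text \<open>Conditional expectation of a vector-valued random variable, taken coordinatewise.\<close>

definition vec_cond_exp ::
  "'o measure \<Rightarrow> 'o measure \<Rightarrow> ('o \<Rightarrow> 'a::euclidean_space) \<Rightarrow> 'o \<Rightarrow> 'a" where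
  "vec_cond_exp M N Y \<omega> = (\<Sum>e\<in>Basis. real_cond_exp M N (\<lambda>\<omega>'. Y \<omega>' \<bullet> e) \<omega> *\<^sub>R e)"

end

theory Submission
  imports Defs
begin

text \<open>Summing \<open>\<parallel>x\<^bsub>k+1\<^esub> - x\<^sub>k\<parallel>\<^sup>2 \<le> 2 (\<eta>\<^sup>2 + D\<^sup>2) (ln S\<^bsub>k+1\<^esub> - ln S\<^sub>k)\<close>, which follows from
  \<open>ln u \<ge> 1 - 1/u\<close> for \<open>u = S\<^bsub>k+1\<^esub>\<^sup>2 / S\<^sub>k\<^sup>2\<close>, bounds the total squared movement by a multiple of
  \<open>ln (S\<^bsub>t+1\<^esub> / \<gamma>)\<close>. The Cauchy--Schwarz inequality, the mini-batch variance bound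
  \<open>E \<parallel>\<delta>\<^sub>k\<parallel>\<^sup>2 \<le> \<sigma>\<^sup>2 / b\<^sub>k\<close> and Jensen's inequality for \<open>ln\<close> then give the claim. The variance bound rests
  on the adaptedness of the iterates, hence on the measurability of the proximal map, which is
  continuous by strong convexity, and on the independence of each sample from all the others.\<close>

subsection \<open>The proximal map\<close>

text \<open>Comparison with a point where \<open>h\<close> is finite forces \<open>h p\<close> to be
  finite. For the inequality, \<open>p\<close> is compared with points of the segment from
  \<open>p\<close> to \<open>v\<close>, and the first-order term is isolated by letting the point
  tend to \<open>p\<close>.\<close>

lemma prox_variational_ineq:
  fixes h :: "'a::real_inner \<Rightarrow> ereal"
  assumes h: "convex_ereal h" "proper_ereal h"
    and min: "is_arg_min (\<lambda>u. ereal (g \<bullet> u + s / 2 * (norm (u - y))\<^sup>2) + h u) (\<lambda>_. True) p"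
  shows "\<bar>h p\<bar> \<noteq> \<infinity>"
    and "\<bar>h v\<bar> \<noteq> \<infinity> \<Longrightarrow> real_of_ereal (h p) - real_of_ereal (h v) \<le> (g + s *\<^sub>R (p - y)) \<bullet> (v - p)"
proof -
  have le: "ereal (g \<bullet> p + s / 2 * (norm (p - y))\<^sup>2) + h p
      \<le> ereal (g \<bullet> u + s / 2 * (norm (u - y))\<^sup>2) + h u" for u
    using min by (auto simp: is_arg_min_def not_less)
  obtain u where u: "h u \<noteq> \<infinity>" using h(2) by (auto simp: proper_ereal_def)
  have mi: "h u \<noteq> -\<infinity>" for u using h(2) by (auto simp: proper_ereal_def)
  show hp: "\<bar>h p\<bar> \<noteq> \<infinity>"
    using le[of u] u mi[of u] mi[of p] by (cases "h u"; cases "h p") auto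
  assume hv: "\<bar>h v\<bar> \<noteq> \<infinity>"
  obtain c where c: "h p = ereal c" using hp by (cases "h p") auto
  obtain d where d: "h v = ereal d" using hv by (cases "h v") auto
  have norm_sq: "(norm (a + t *\<^sub>R b))\<^sup>2 = (norm a)\<^sup>2 + 2 * t * (a \<bullet> b) + t\<^sup>2 * (norm b)\<^sup>2" for a b :: 'a and t
    unfolding power2_norm_eq_inner by (simp add: inner_commute algebra_simps power2_eq_square)
  \<comment> \<open>Minimality of \<open>p\<close> against \<open>?u\<close> and convexity of
    \<open>h\<close>, divided by \<open>t\<close>. The quadratic term of the objective survives only
    as an error proportional to \<open>t\<close>, which vanishes as \<open>t\<close> tends to 0 from
    the right.\<close>
  have ineq: "c - d \<le> (g + s *\<^sub>R (p - y)) \<bullet> (v - p) + t * (s / 2 * (norm (v - p))\<^sup>2)"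
    if t: "0 < t" "t < 1" for t
  proof -
    let ?u = "(1 - t) *\<^sub>R p + t *\<^sub>R v"
    have "h ?u \<le> ereal ((1 - t) * c + t * d)"
      using h(1)[unfolded convex_ereal_def, rule_format, of t p v] t c d by simp
    then have "ereal (g \<bullet> p + s / 2 * (norm (p - y))\<^sup>2) + ereal c
      \<le> ereal (g \<bullet> ?u + s / 2 * (norm (?u - y))\<^sup>2) + ereal ((1 - t) * c + t * d)"
      using order_trans[OF le[of ?u] add_left_mono] unfolding c by blast
    then have *: "g \<bullet> p + s / 2 * (norm (p - y))\<^sup>2 + c
      \<le> g \<bullet> ?u + s / 2 * (norm (?u - y))\<^sup>2 + ((1 - t) * c + t * d)" by simp
    have "?u - y = (p - y) + t *\<^sub>R (v - p)" by (simp add: algebra_simps)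
    then have u: "(norm (?u - y))\<^sup>2 = (norm (p - y))\<^sup>2 + 2 * t * ((p - y) \<bullet> (v - p)) + t\<^sup>2 * (norm (v - p))\<^sup>2"
      unfolding norm_sq[symmetric] by (rule arg_cong)
    have "g \<bullet> ?u = g \<bullet> p + t * (g \<bullet> (v - p))" by (simp add: algebra_simps)
    from *[unfolded u this]
    have "t * (c - d) \<le> t * ((g + s *\<^sub>R (p - y)) \<bullet> (v - p) + t * (s / 2 * (norm (v - p))\<^sup>2))"
      unfolding inner_add_left inner_scaleR_left by (simp add: algebra_simps power2_eq_square)
    then show ?thesis using t by simp
  qed
  have "((\<lambda>t. (g + s *\<^sub>R (p - y)) \<bullet> (v - p) + t * (s / 2 * (norm (v - p))\<^sup>2)) \<longlongrightarrow>
      (g + s *\<^sub>R (p - y)) \<bullet> (v - p) + 0 * (s / 2 * (norm (v - p))\<^sup>2)) (at_right 0)"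
    by (intro tendsto_intros)
  moreover have "eventually (\<lambda>t. c - d \<le> (g + s *\<^sub>R (p - y)) \<bullet> (v - p) + t * (s / 2 * (norm (v - p))\<^sup>2)) (at_right 0)"
    using ineq by (auto simp: eventually_at_right_field intro!: exI[of _ 1])
  ultimately have "c - d \<le> (g + s *\<^sub>R (p - y)) \<bullet> (v - p)"
    using tendsto_lowerbound[of _ _ "at_right (0::real)" "c - d"] by fastforce
  then show "real_of_ereal (h p) - real_of_ereal (h v) \<le> (g + s *\<^sub>R (p - y)) \<bullet> (v - p)"
    by (simp add: c d)
qed

text \<open>Each minimizer is tested in the variational inequality of the other; the values of
  \<open>h\<close> cancel on addition, and the quadratic term leaves
  \<open>s * (norm (p - p'))\<^sup>2\<close>. The bound is deliberately asymmetric: with the primed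
  data and \<open>p'\<close> fixed, its right-hand side tends to 0 as the other data approach them.
  For equal data with \<open>s > 0\<close> it gives uniqueness.\<close>

lemma prox_stability:
  fixes h :: "'a::real_inner \<Rightarrow> ereal"
  assumes h: "convex_ereal h" "proper_ereal h"
    and p: "is_arg_min (\<lambda>u. ereal (g \<bullet> u + s / 2 * (norm (u - y))\<^sup>2) + h u) (\<lambda>_. True) p"
    and p': "is_arg_min (\<lambda>u. ereal (g' \<bullet> u + s' / 2 * (norm (u - y'))\<^sup>2) + h u) (\<lambda>_. True) p'"
  shows "s * norm (p - p') \<le> norm (g - g' + (s - s') *\<^sub>R p' - (s *\<^sub>R y - s' *\<^sub>R y'))"
proof -
  let ?w = "g - g' + (s - s') *\<^sub>R p' - (s *\<^sub>R y - s' *\<^sub>R y')"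
  note fin = prox_variational_ineq(1)[OF h p] prox_variational_ineq(1)[OF h p']
  have "0 \<le> (g + s *\<^sub>R (p - y)) \<bullet> (p' - p) + (g' + s' *\<^sub>R (p' - y')) \<bullet> (p - p')"
    using prox_variational_ineq(2)[OF h p fin(2)] prox_variational_ineq(2)[OF h p' fin(1)] by linarith
  also have "\<dots> = ?w \<bullet> (p' - p) - s * (norm (p - p'))\<^sup>2"
    by (simp add: power2_norm_eq_inner algebra_simps inner_commute)
  also have "\<dots> \<le> norm ?w * norm (p - p') - s * (norm (p - p'))\<^sup>2"
    using norm_cauchy_schwarz[of ?w "p' - p"] by (simp add: norm_minus_commute)
  finally have "norm (p - p') * (s * norm (p - p')) \<le> norm (p - p') * norm ?w"
    by (simp add: power2_eq_square algebra_simps)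
  then show ?thesis by (cases "p = p'") auto
qed

text \<open>The set of data \<open>(g, s, y)\<close> for which a minimizer exists need not be known: continuity on the
  range of the data suffices.\<close>

lemma borel_measurable_prox:
  fixes h :: "'a::euclidean_space \<Rightarrow> ereal"
  assumes h: "convex_ereal h" "proper_ereal h"
    and [measurable]: "g \<in> borel_measurable N" "s \<in> borel_measurable N" "y \<in> borel_measurable N"
    and pos: "\<And>\<omega>. \<omega> \<in> space N \<Longrightarrow> s \<omega> > 0"
    and min: "\<And>\<omega>. \<omega> \<in> space N \<Longrightarrow>
      is_arg_min (\<lambda>u. ereal (g \<omega> \<bullet> u + s \<omega> / 2 * (norm (u - y \<omega>))\<^sup>2) + h u) (\<lambda>_. True) (p \<omega>)"
  shows "p \<in> borel_measurable N"
proof -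
  define T where "T \<omega> = (g \<omega>, s \<omega>, y \<omega>)" for \<omega>
  \<comment> \<open>A choice that depends on the data triple alone. Uniqueness of the minimizer
    makes it agree with \<open>p\<close> on \<open>space N\<close>, so \<open>p\<close> factors
    through \<open>T\<close>.\<close>
  define pr where "pr a = (case a of (g, s, y) \<Rightarrow>
    (SOME p. is_arg_min (\<lambda>u. ereal (g \<bullet> u + s / 2 * (norm (u - y))\<^sup>2) + h u) (\<lambda>_. True) p))" for a
  have pr_min: "is_arg_min (\<lambda>u. ereal (g \<omega> \<bullet> u + s \<omega> / 2 * (norm (u - y \<omega>))\<^sup>2) + h u) (\<lambda>_. True) (pr (T \<omega>))"
    if "\<omega> \<in> space N" for \<omega>
    unfolding pr_def T_def prod.case by (rule someI, rule min[OF that])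
  have eq: "p \<omega> = pr (T \<omega>)" if "\<omega> \<in> space N" for \<omega>
    using prox_stability[OF h min[OF that] pr_min[OF that]] pos[OF that] by (simp add: mult_le_0_iff)
  have "continuous_on (T ` space N) pr"
    unfolding continuous_on_def
  proof
    fix a assume "a \<in> T ` space N"
    then obtain w where w: "w \<in> space N" "a = T w" by auto
    \<comment> \<open>The bound of \<open>prox_stability\<close> divided by its \<open>s\<close>,
      with the second set of data frozen at \<open>T w\<close>. It is continuous there, since
      \<open>s w > 0\<close>, and its value at \<open>T w\<close> is 0.\<close>
    let ?b = "\<lambda>a. norm (fst a - g w + (fst (snd a) - s w) *\<^sub>R pr (T w)
       - (fst (snd a) *\<^sub>R snd (snd a) - s w *\<^sub>R y w)) / fst (snd a)"
    have "(?b \<longlongrightarrow> norm (fst (T w) - g w + (fst (snd (T w)) - s w) *\<^sub>R pr (T w)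
       - (fst (snd (T w)) *\<^sub>R snd (snd (T w)) - s w *\<^sub>R y w)) / fst (snd (T w))) (at (T w) within T ` space N)"
      using pos[OF w(1)] by (intro tendsto_intros) (simp add: T_def)
    then have "(?b \<longlongrightarrow> 0) (at (T w) within T ` space N)"
      by (simp add: T_def)
    moreover have "\<forall>\<^sub>F a in at (T w) within T ` space N. norm (pr a - pr (T w)) \<le> ?b a"
      unfolding eventually_at_filter
    proof (intro always_eventually allI impI)
      fix a assume "a \<in> T ` space N"
      then obtain v where v: "v \<in> space N" "a = T v" by auto
      show "norm (pr a - pr (T w)) \<le> ?b a"
        using prox_stability[OF h pr_min[OF v(1)] pr_min[OF w(1)]] pos[OF v(1)]
        by (simp add: v(2) T_def field_simps)
    qed
    ultimately have "((\<lambda>a. pr a - pr (T w)) \<longlongrightarrow> 0) (at (T w) within T ` space N)"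
      by (rule Lim_null_comparison[rotated])
    then show "(pr \<longlongrightarrow> pr a) (at a within T ` space N)"
      by (simp add: w(2) LIM_zero_iff)
  qed
  then have "pr \<in> borel_measurable (restrict_space borel (T ` space N))"
    by (rule borel_measurable_continuous_on_restrict)
  moreover have "T \<in> measurable N (restrict_space borel (T ` space N))"
    by (rule measurable_restrict_space2) (auto simp: T_def[abs_def])
  ultimately have "(\<lambda>\<omega>. pr (T \<omega>)) \<in> borel_measurable N"
    by (rule measurable_compose_rev)
  then show ?thesis by (simp add: eq cong: measurable_cong)
qed

subsection \<open>Samples that are independent of the past\<close>

text \<open>The index type is arbitrary, so that pairs (iteration, position in the batch) can serve
  as indices. The generator is a union of the preimage families of the single variables, the form in
  which independence passes to blocks of variables; for empty \<open>K\<close> the trivial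
  \<sigma>-algebra results.\<close>

definition sigma_generated ::
  "'o measure \<Rightarrow> 'z measure \<Rightarrow> ('i \<Rightarrow> 'o \<Rightarrow> 'z) \<Rightarrow> 'i set \<Rightarrow> 'o measure" where
  "sigma_generated M P X K =
    sigma (space M) (\<Union>i\<in>K. {X i -` A \<inter> space M | A. A \<in> sets P})"

lemma space_sigma_generated [simp]: "space (sigma_generated M P X K) = space M"
  unfolding sigma_generated_def by (rule space_measure_of) auto

lemma sets_sigma_generated:
  "sets (sigma_generated M P X K) =
    sigma_sets (space M) (\<Union>i\<in>K. {X i -` A \<inter> space M | A. A \<in> sets P})"
  unfolding sigma_generated_def by (rule sets_measure_of) auto

lemma subalgebra_sigma_generated:
  assumes "\<And>i. i \<in> K \<Longrightarrow> X i \<in> measurable M P"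
  shows "subalgebra M (sigma_generated M P X K)"
  unfolding subalgebra_def sets_sigma_generated space_sigma_generated
  using assms by (auto intro!: sets.sigma_sets_subset measurable_sets)

lemma measurable_sigma_generated:
  assumes "X i \<in> measurable M P" "i \<in> K"
  shows "X i \<in> measurable (sigma_generated M P X K) P"
  using assms unfolding measurable_def sets_sigma_generated
  by (auto intro!: sigma_sets.Basic)

lemma measurable_ident_sigma_generated_mono:
  assumes "K \<subseteq> L"
  shows "(\<lambda>\<omega>. \<omega>) \<in> measurable (sigma_generated M P X L) (sigma_generated M P X K)"
proof -
  have "sets (sigma_generated M P X K) \<subseteq> sets (sigma_generated M P X L)"
    unfolding sets_sigma_generated using assms by (intro sigma_sets_mono') auto
  then show ?thesis
    by (intro measurable_from_subalg[OF _ measurable_ident_sets]) (auto simp: subalgebra_def)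
qed

lemma measurable_sigma_generated_mono:
  assumes "f \<in> measurable (sigma_generated M P X K) N" "K \<subseteq> L"
  shows "f \<in> measurable (sigma_generated M P X L) N"
  using measurable_compose[OF measurable_ident_sigma_generated_mono[OF assms(2)] assms(1)] .

lemma past_samples_eq:
  "past_samples M P b \<xi> k =
    sigma_generated M P (\<lambda>(i, j). \<xi> i j) (SIGMA i:{1..<k}. {1..b i})"
  unfolding past_samples_def sigma_generated_def
  by (rule arg_cong2[where f = sigma]) fastforce+

text \<open>The point \<open>\<omega>\<close>, read through the coarser \<sigma>-algebra
  \<open>H\<close>, stands for the whole past. Independence of \<open>H\<close> from
  \<open>X i\<close> makes the joint law a product, which is checked on rectangles.\<close>

lemma (in prob_space) distr_pair_sigma_generated:
  assumes ind: "indep_vars (\<lambda>_. P) X I" and K: "K \<subseteq> I" "i \<in> I" "i \<notin> K"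
  defines "H \<equiv> sigma_generated M P X K"
  shows "distr M (H \<Otimes>\<^sub>M P) (\<lambda>\<omega>. (\<omega>, X i \<omega>)) = distr M H (\<lambda>\<omega>. \<omega>) \<Otimes>\<^sub>M distr M P (X i)"
proof -
  have X: "X j \<in> measurable M P" if "j \<in> I" for j
    using ind that by (auto simp: indep_vars_def)
  have sub: "subalgebra M H"
    unfolding H_def using K X by (intro subalgebra_sigma_generated) auto
  have id: "(\<lambda>\<omega>. \<omega>) \<in> measurable M H"
    using sub by (intro measurable_from_subalg[OF _ measurable_ident_sets]) auto
  let ?E = "\<lambda>j. {X j -` A \<inter> space M | A. A \<in> sets P}"
  \<comment> \<open>The booleans index the two disjoint blocks \<open>K\<close> and
    \<open>{i}\<close>. Grouping an independent family of intersection-stable generators along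
    disjoint blocks yields independent \<sigma>-algebras.\<close>
  have "indep_sets (\<lambda>c. sigma_sets (space M) (\<Union>j\<in>(case_bool K {i} c). ?E j)) UNIV"
  proof (rule indep_sets_collect_sigma)
    show "indep_sets ?E (\<Union>c\<in>UNIV. case_bool K {i} c)"
      using ind K by (auto simp: indep_vars_def2 UNIV_bool intro: indep_sets_mono_index)
    show "Int_stable (?E j)" for j
    proof (rule Int_stableI)
      fix A B assume "A \<in> ?E j" "B \<in> ?E j"
      then obtain A' B' where "A = X j -` A' \<inter> space M" "A' \<in> sets P"
        "B = X j -` B' \<inter> space M" "B' \<in> sets P" by auto
      then show "A \<inter> B \<in> ?E j" by (auto intro!: exI[of _ "A' \<inter> B'"])
    qed
    show "disjoint_family (case_bool K {i})"
      using K by (auto simp: disjoint_family_on_def split: bool.split)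
  qed
  moreover have "(\<lambda>c. sigma_sets (space M) (\<Union>j\<in>(case_bool K {i} c). ?E j)) =
      case_bool (sets H) (sigma_sets (space M) (?E i))"
    by (auto simp: fun_eq_iff H_def sets_sigma_generated split: bool.split)
  ultimately have "indep_set (sets H) (sigma_sets (space M) (?E i))"
    by (simp add: indep_set_def)
  then have prod: "prob (A \<inter> (X i -` B \<inter> space M)) = prob A * prob (X i -` B \<inter> space M)"
    if "A \<in> sets H" "B \<in> sets P" for A B
    using that by (intro indep_setD) (auto intro!: sigma_sets.Basic)
  interpret dH: prob_space "distr M H (\<lambda>\<omega>. \<omega>)" by (rule prob_space_distr[OF id])
  interpret dP: prob_space "distr M P (X i)" by (rule prob_space_distr[OF X[OF K(2)]])
  have pair: "(\<lambda>\<omega>. (\<omega>, X i \<omega>)) \<in> measurable M (H \<Otimes>\<^sub>M P)"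
    using id X[OF K(2)] by simp
  show ?thesis
  proof (rule pair_measure_eqI[symmetric])
    show "sigma_finite_measure (distr M H (\<lambda>\<omega>. \<omega>))" "sigma_finite_measure (distr M P (X i))"
      by unfold_locales
    show "sets (distr M H (\<lambda>\<omega>. \<omega>) \<Otimes>\<^sub>M distr M P (X i)) =
        sets (distr M (H \<Otimes>\<^sub>M P) (\<lambda>\<omega>. (\<omega>, X i \<omega>)))"
      by (simp cong: sets_pair_measure_cong)
    fix A B assume "A \<in> sets (distr M H (\<lambda>\<omega>. \<omega>))" "B \<in> sets (distr M P (X i))"
    then have AB: "A \<in> sets H" "B \<in> sets P" by auto
    then have "A \<in> sets M" "A \<inter> space M = A"
      using sub sets.sets_into_space[of A H] by (auto simp: subalgebra_def H_def)
    moreover have "(\<lambda>\<omega>. (\<omega>, X i \<omega>)) -` (A \<times> B) \<inter> space M = A \<inter> (X i -` B \<inter> space M)"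
      by auto
    ultimately show "emeasure (distr M H (\<lambda>\<omega>. \<omega>)) A * emeasure (distr M P (X i)) B =
        emeasure (distr M (H \<Otimes>\<^sub>M P) (\<lambda>\<omega>. (\<omega>, X i \<omega>))) (A \<times> B)"
      using AB prod[OF AB] id pair X[OF K(2)]
      by (simp add: emeasure_distr emeasure_eq_measure ennreal_mult[symmetric])
  qed
qed

text \<open>The left-hand side has the shape in which \<open>real_cond_exp\<close> is defined, a
  difference of two nonnegative parts.\<close>

lemma enn2real_diff_eq_integral:
  fixes f :: "'a \<Rightarrow> real"
  assumes "integrable N f"
  shows "enn2real (\<integral>\<^sup>+z. ennreal (f z) \<partial>N) - enn2real (\<integral>\<^sup>+z. ennreal (- f z) \<partial>N) = (\<integral>z. f z \<partial>N)"
  using assms by (simp add: real_lebesgue_integral_def)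

lemma (in prob_space) square_integrable_imp_integrable:
  fixes f :: "'a \<Rightarrow> 'b::{banach, second_countable_topology}"
  assumes [measurable]: "f \<in> borel_measurable M" and "integrable M (\<lambda>\<omega>. (norm (f \<omega>))\<^sup>2)"
  shows "integrable M f"
proof (rule Bochner_Integration.integrable_bound)
  show "integrable M (\<lambda>\<omega>. 1 + (norm (f \<omega>))\<^sup>2)" using assms by simp
  have "r \<le> 1 + r\<^sup>2" for r :: real
    using zero_le_power2[of "r - 1 / 2"] by (simp add: power2_eq_square algebra_simps)
  then show "AE \<omega> in M. norm (f \<omega>) \<le> norm (1 + (norm (f \<omega>))\<^sup>2)"
    by (auto simp: abs_of_nonneg)
qed simp

text \<open>\<open>K\<close> indexes what is already known, and \<open>X i\<close> is a further
  sample with law \<open>P\<close>. \<open>K\<close> stays general because the variance estimate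
  later enlarges the past by another sample of the same batch.\<close>

locale fresh_sample = prob_space M + P: prob_space P
  for M :: "'o measure" and P :: "'z measure" +
  fixes X :: "'i \<Rightarrow> 'o \<Rightarrow> 'z" and I :: "'i set" and K :: "'i set" and i :: 'i
  assumes indep: "indep_vars (\<lambda>_. P) X I"
    and K_subset: "K \<subseteq> I" and i_in: "i \<in> I" and i_notin: "i \<notin> K"
    and distr_X: "distr M P (X i) = P"
begin

abbreviation H :: "'o measure" where "H \<equiv> sigma_generated M P X K"

lemma X_measurable [measurable]: "X i \<in> measurable M P"
  using indep i_in by (auto simp: indep_vars_def)

lemma subalgebra_H: "subalgebra M H"
  using indep K_subset by (intro subalgebra_sigma_generated) (auto simp: indep_vars_def)

lemma measurable_ident_H [measurable]: "(\<lambda>\<omega>. \<omega>) \<in> measurable M H"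
  using subalgebra_H by (intro measurable_from_subalg[OF _ measurable_ident_sets]) auto

sublocale H: finite_measure_subalgebra M H
  by unfold_locales (rule subalgebra_H)

sublocale dH: prob_space "distr M H (\<lambda>\<omega>. \<omega>)"
  by (rule prob_space_distr) measurable

sublocale dHP: pair_sigma_finite "distr M H (\<lambda>\<omega>. \<omega>)" P ..

lemma distr_pair: "distr M (H \<Otimes>\<^sub>M P) (\<lambda>\<omega>. (\<omega>, X i \<omega>)) = distr M H (\<lambda>\<omega>. \<omega>) \<Otimes>\<^sub>M P"
  using distr_pair_sigma_generated[OF indep K_subset i_in i_notin] by (simp add: distr_X)

text \<open>By the product form of the joint law and Tonelli, the sample may be averaged out while
  \<open>\<omega>\<close> is frozen in the first argument.\<close>

lemma nn_integral_fresh: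
  assumes [measurable]: "\<phi> \<in> borel_measurable (H \<Otimes>\<^sub>M P)"
  shows "(\<integral>\<^sup>+\<omega>. \<phi> (\<omega>, X i \<omega>) \<partial>M) = (\<integral>\<^sup>+\<omega>. \<integral>\<^sup>+z. \<phi> (\<omega>, z) \<partial>P \<partial>M)"
proof -
  have m: "\<phi> \<in> borel_measurable (distr M H (\<lambda>\<omega>. \<omega>) \<Otimes>\<^sub>M P)"
    using assms by (simp cong: measurable_cong_sets sets_pair_measure_cong)
  have "(\<integral>\<^sup>+\<omega>. \<phi> (\<omega>, X i \<omega>) \<partial>M) = (\<integral>\<^sup>+p. \<phi> p \<partial>distr M (H \<Otimes>\<^sub>M P) (\<lambda>\<omega>. (\<omega>, X i \<omega>)))"
    by (simp add: nn_integral_distr)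
  also have "\<dots> = (\<integral>\<^sup>+\<omega>. \<integral>\<^sup>+z. \<phi> (\<omega>, z) \<partial>P \<partial>distr M H (\<lambda>\<omega>. \<omega>))"
    unfolding distr_pair by (rule P.nn_integral_fst[OF m, symmetric])
  also have "\<dots> = (\<integral>\<^sup>+\<omega>. \<integral>\<^sup>+z. \<phi> (\<omega>, z) \<partial>P \<partial>M)"
    by (simp add: nn_integral_distr)
  finally show ?thesis .
qed

lemma integral_fresh:
  fixes \<phi> :: "'o \<times> 'z \<Rightarrow> 'b::{banach, second_countable_topology}"
  assumes [measurable]: "\<phi> \<in> borel_measurable (H \<Otimes>\<^sub>M P)"
    and int: "integrable M (\<lambda>\<omega>. \<phi> (\<omega>, X i \<omega>))"
  shows "(\<integral>\<omega>. \<phi> (\<omega>, X i \<omega>) \<partial>M) = (\<integral>\<omega>. \<integral>z. \<phi> (\<omega>, z) \<partial>P \<partial>M)"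
proof -
  have "integrable (distr M H (\<lambda>\<omega>. \<omega>) \<Otimes>\<^sub>M P) \<phi>"
    using int unfolding distr_pair[symmetric] by (simp add: integrable_distr_eq)
  then have "(\<integral>p. \<phi> p \<partial>(distr M H (\<lambda>\<omega>. \<omega>) \<Otimes>\<^sub>M P)) =
      (\<integral>\<omega>. \<integral>z. \<phi> (\<omega>, z) \<partial>P \<partial>distr M H (\<lambda>\<omega>. \<omega>))"
    by (rule dHP.integral_fst'[symmetric])
  moreover have "(\<integral>p. \<phi> p \<partial>(distr M H (\<lambda>\<omega>. \<omega>) \<Otimes>\<^sub>M P)) = (\<integral>\<omega>. \<phi> (\<omega>, X i \<omega>) \<partial>M)"
    unfolding distr_pair[symmetric] by (simp add: integral_distr)
  ultimately show ?thesis by (simp add: integral_distr)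
qed

text \<open>Conditioning on the past amounts to freezing \<open>\<omega>\<close> and integrating
  over the sample: multiplying \<open>\<phi>\<close> by the indicator of a set \<open>A\<close> of
  \<open>H\<close> preserves joint measurability, so \<open>nn_integral_fresh\<close> verifies the
  defining identity on \<open>A\<close>.\<close>

lemma nn_cond_exp_fresh:
  assumes [measurable]: "\<phi> \<in> borel_measurable (H \<Otimes>\<^sub>M P)"
  shows "AE \<omega> in M. nn_cond_exp M H (\<lambda>\<omega>. \<phi> (\<omega>, X i \<omega>)) \<omega> = (\<integral>\<^sup>+z. \<phi> (\<omega>, z) \<partial>P)"
proof -
  have "AE \<omega> in M. (\<integral>\<^sup>+z. \<phi> (\<omega>, z) \<partial>P) = nn_cond_exp M H (\<lambda>\<omega>. \<phi> (\<omega>, X i \<omega>)) \<omega>"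
  proof (rule H.nn_cond_exp_charact)
    fix A assume [measurable]: "A \<in> sets H"
    have "(\<integral>\<^sup>+\<omega>\<in>A. \<phi> (\<omega>, X i \<omega>) \<partial>M) = (\<integral>\<^sup>+\<omega>. \<integral>\<^sup>+z. \<phi> (\<omega>, z) * indicator A \<omega> \<partial>P \<partial>M)"
      using nn_integral_fresh[of "\<lambda>(\<omega>, z). \<phi> (\<omega>, z) * indicator A \<omega>"] by simp
    also have "\<dots> = (\<integral>\<^sup>+\<omega>\<in>A. (\<integral>\<^sup>+z. \<phi> (\<omega>, z) \<partial>P) \<partial>M)"
    proof (rule nn_integral_cong)
      fix \<omega> assume "\<omega> \<in> space M"
      then have "\<omega> \<in> space H" by simp
      then show "(\<integral>\<^sup>+z. \<phi> (\<omega>, z) * indicator A \<omega> \<partial>P) = (\<integral>\<^sup>+z. \<phi> (\<omega>, z) \<partial>P) * indicator A \<omega>"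
        by (intro nn_integral_multc) simp
    qed
    finally show "(\<integral>\<^sup>+\<omega>\<in>A. \<phi> (\<omega>, X i \<omega>) \<partial>M) = (\<integral>\<^sup>+\<omega>\<in>A. (\<integral>\<^sup>+z. \<phi> (\<omega>, z) \<partial>P) \<partial>M)" .
  qed measurable
  then show ?thesis by (auto elim: AE_mp)
qed

text \<open>No integrability of \<open>\<phi> (\<omega>, X i \<omega>)\<close> on \<open>M\<close> is available, since \<open>gf (x k \<omega>)\<close> may fail to be
  integrable. It is enough that \<open>\<phi> (\<omega>, \<cdot>)\<close> is integrable for almost every \<open>\<omega>\<close>.\<close>

lemma vec_cond_exp_fresh:
  fixes \<phi> :: "'o \<times> 'z \<Rightarrow> 'a::euclidean_space"
  assumes [measurable]: "\<phi> \<in> borel_measurable (H \<Otimes>\<^sub>M P)"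
    and int: "AE \<omega> in M. integrable P (\<lambda>z. \<phi> (\<omega>, z))"
  shows "AE \<omega> in M. vec_cond_exp M H (\<lambda>\<omega>. \<phi> (\<omega>, X i \<omega>)) \<omega> = (\<integral>z. \<phi> (\<omega>, z) \<partial>P)"
proof -
  \<comment> \<open>Positive and negative parts are treated separately for each coordinate, where no
    integrability is required; the basis is finite, so one null set serves all coordinates.\<close>
  have "AE \<omega> in M. \<forall>e\<in>Basis.
      nn_cond_exp M H (\<lambda>\<omega>. ennreal (\<phi> (\<omega>, X i \<omega>) \<bullet> e)) \<omega> = (\<integral>\<^sup>+z. ennreal (\<phi> (\<omega>, z) \<bullet> e) \<partial>P) \<and>
      nn_cond_exp M H (\<lambda>\<omega>. ennreal (- (\<phi> (\<omega>, X i \<omega>) \<bullet> e))) \<omega> = (\<integral>\<^sup>+z. ennreal (- (\<phi> (\<omega>, z) \<bullet> e)) \<partial>P)"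
    by (intro AE_finite_allI AE_conjI finite_Basis
        nn_cond_exp_fresh[of "\<lambda>p. ennreal (\<phi> p \<bullet> _)"] nn_cond_exp_fresh[of "\<lambda>p. ennreal (- (\<phi> p \<bullet> _))"])
      measurable
  then show ?thesis
    using int
  proof eventually_elim
    case (elim \<omega>)
    have "vec_cond_exp M H (\<lambda>\<omega>. \<phi> (\<omega>, X i \<omega>)) \<omega> = (\<Sum>e\<in>Basis. (\<integral>z. \<phi> (\<omega>, z) \<bullet> e \<partial>P) *\<^sub>R e)"
      using elim unfolding vec_cond_exp_def real_cond_exp_def
      by (intro sum.cong refl arg_cong[where f = "\<lambda>r. r *\<^sub>R _"]) (simp add: enn2real_diff_eq_integral)
    also have "\<dots> = (\<Sum>e\<in>Basis. ((\<integral>z. \<phi> (\<omega>, z) \<partial>P) \<bullet> e) *\<^sub>R e)"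
      using elim by simp
    finally show ?case by (simp add: euclidean_representation)
  qed
qed

end

context fresh_sample
begin

text \<open>The finite second moment of the difference makes its inner integral over
  \<open>P\<close> finite for almost every \<open>\<omega>\<close>. Hence the difference, and with
  it \<open>\<phi> (\<omega>, \<cdot>)\<close>, is integrable in the sample, and the conditional
  mean \<open>V \<omega>\<close> becomes an ordinary integral over \<open>P\<close>.\<close>

lemma centred_fresh:
  fixes \<phi> :: "'o \<times> 'z \<Rightarrow> 'a::euclidean_space"
  assumes [measurable]: "\<phi> \<in> borel_measurable (H \<Otimes>\<^sub>M P)" "V \<in> borel_measurable H"
    and V: "AE \<omega> in M. vec_cond_exp M H (\<lambda>\<omega>. \<phi> (\<omega>, X i \<omega>)) \<omega> = V \<omega>"
    and fin: "(\<integral>\<^sup>+\<omega>. ennreal ((norm (\<phi> (\<omega>, X i \<omega>) - V \<omega>))\<^sup>2) \<partial>M) < \<infinity>"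
  shows "AE \<omega> in M. integrable P (\<lambda>z. \<phi> (\<omega>, z) - V \<omega>) \<and> (\<integral>z. \<phi> (\<omega>, z) - V \<omega> \<partial>P) = 0"
proof -
  have "(\<integral>\<^sup>+\<omega>. \<integral>\<^sup>+z. ennreal ((norm (\<phi> (\<omega>, z) - V \<omega>))\<^sup>2) \<partial>P \<partial>M) \<noteq> \<infinity>"
    using fin nn_integral_fresh[of "\<lambda>(\<omega>, z). ennreal ((norm (\<phi> (\<omega>, z) - V \<omega>))\<^sup>2)"] by simp
  moreover have "(\<lambda>\<omega>. \<integral>\<^sup>+z. ennreal ((norm (\<phi> (\<omega>, z) - V \<omega>))\<^sup>2) \<partial>P) \<in> borel_measurable H"
    by measurable
  then have "(\<lambda>\<omega>. \<integral>\<^sup>+z. ennreal ((norm (\<phi> (\<omega>, z) - V \<omega>))\<^sup>2) \<partial>P) \<in> borel_measurable M"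
    by (rule measurable_from_subalg[OF subalgebra_H])
  ultimately have "AE \<omega> in M. (\<integral>\<^sup>+z. ennreal ((norm (\<phi> (\<omega>, z) - V \<omega>))\<^sup>2) \<partial>P) \<noteq> \<infinity>"
    by (intro nn_integral_PInf_AE)
  then have int: "AE \<omega> in M. integrable P (\<lambda>z. \<phi> (\<omega>, z) - V \<omega>)"
  proof (rule AE_mp, intro AE_I2 impI)
    fix \<omega> assume "\<omega> \<in> space M"
      and sq: "(\<integral>\<^sup>+z. ennreal ((norm (\<phi> (\<omega>, z) - V \<omega>))\<^sup>2) \<partial>P) \<noteq> \<infinity>"
    then have "\<omega> \<in> space H" by simp
    then have [measurable]: "(\<lambda>z. \<phi> (\<omega>, z)) \<in> borel_measurable P" by simp
    have "integrable P (\<lambda>z. (norm (\<phi> (\<omega>, z) - V \<omega>))\<^sup>2)"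
      using sq by (intro integrableI_bounded) (auto simp: top.not_eq_extremum)
    then show "integrable P (\<lambda>z. \<phi> (\<omega>, z) - V \<omega>)"
      by (rule P.square_integrable_imp_integrable[rotated]) measurable
  qed
  then have int': "AE \<omega> in M. integrable P (\<lambda>z. \<phi> (\<omega>, z))"
  proof eventually_elim
    case (elim \<omega>)
    from Bochner_Integration.integrable_add[OF this, of "\<lambda>_. V \<omega>"] show ?case by simp
  qed
  show ?thesis
    using vec_cond_exp_fresh[OF assms(1) int'] V int int'
    by eventually_elim (simp add: P.prob_space)
qed

text \<open>\<open>Y\<close> is constant once \<open>\<omega>\<close> is frozen and leaves the inner
  integral, which then vanishes. This is the source of orthogonality between samples of one
  batch.\<close>

lemma integral_inner_fresh_zero:
  fixes \<psi> :: "'o \<times> 'z \<Rightarrow> 'a::euclidean_space"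
  assumes [measurable]: "\<psi> \<in> borel_measurable (H \<Otimes>\<^sub>M P)" "Y \<in> borel_measurable H"
    and zero: "AE \<omega> in M. integrable P (\<lambda>z. \<psi> (\<omega>, z)) \<and> (\<integral>z. \<psi> (\<omega>, z) \<partial>P) = 0"
    and int: "integrable M (\<lambda>\<omega>. \<psi> (\<omega>, X i \<omega>) \<bullet> Y \<omega>)"
  shows "(\<integral>\<omega>. \<psi> (\<omega>, X i \<omega>) \<bullet> Y \<omega> \<partial>M) = 0"
proof -
  have "(\<integral>\<omega>. \<psi> (\<omega>, X i \<omega>) \<bullet> Y \<omega> \<partial>M) = (\<integral>\<omega>. \<integral>z. \<psi> (\<omega>, z) \<bullet> Y \<omega> \<partial>P \<partial>M)"
    using integral_fresh[of "\<lambda>(\<omega>, z). \<psi> (\<omega>, z) \<bullet> Y \<omega>"] int by simp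
  also have "\<dots> = 0"
    by (rule integral_eq_zero_AE, rule eventually_mono[OF zero]) auto
  finally show ?thesis .
qed

end

section \<open>Variance of the mini-batch gradient\<close>

lemma integrable_inner_square:
  fixes f g :: "'a \<Rightarrow> 'b::euclidean_space"
  assumes [measurable]: "f \<in> borel_measurable M" "g \<in> borel_measurable M"
    and int: "integrable M (\<lambda>x. (norm (f x))\<^sup>2)" "integrable M (\<lambda>x. (norm (g x))\<^sup>2)"
  shows "integrable M (\<lambda>x. f x \<bullet> g x)"
proof (rule Bochner_Integration.integrable_bound)
  show "integrable M (\<lambda>x. (norm (f x))\<^sup>2 + (norm (g x))\<^sup>2)" using int by simp
  have "\<bar>u \<bullet> v\<bar> \<le> (norm u)\<^sup>2 + (norm v)\<^sup>2" for u v :: 'b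
    using Cauchy_Schwarz_ineq2[of u v] sum_squares_bound[of "norm u" "norm v"] 
      mult_nonneg_nonneg[OF norm_ge_zero[of u] norm_ge_zero[of v]] by linarith
  then show "AE x in M. norm (f x \<bullet> g x) \<le> norm ((norm (f x))\<^sup>2 + (norm (g x))\<^sup>2)"
    by auto
qed simp

lemma integral_norm_sum_orthogonal:
  fixes U :: "'i \<Rightarrow> 'a \<Rightarrow> 'b::euclidean_space"
  assumes "finite J"
    and meas: "\<And>j. j \<in> J \<Longrightarrow> U j \<in> borel_measurable M"
    and sq: "\<And>j. j \<in> J \<Longrightarrow> integrable M (\<lambda>x. (norm (U j x))\<^sup>2)"
    and orth: "\<And>i j. i \<in> J \<Longrightarrow> j \<in> J \<Longrightarrow> i \<noteq> j \<Longrightarrow> (\<integral>x. U i x \<bullet> U j x \<partial>M) = 0"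
  shows "integrable M (\<lambda>x. (norm (\<Sum>j\<in>J. U j x))\<^sup>2)"
    and "(\<integral>x. (norm (\<Sum>j\<in>J. U j x))\<^sup>2 \<partial>M) = (\<Sum>j\<in>J. \<integral>x. (norm (U j x))\<^sup>2 \<partial>M)"
proof -
  have int: "integrable M (\<lambda>x. U i x \<bullet> U j x)" if "i \<in> J" "j \<in> J" for i j
    using that by (intro integrable_inner_square meas sq)
  have eq: "(norm (\<Sum>j\<in>J. U j x))\<^sup>2 = (\<Sum>i\<in>J. \<Sum>j\<in>J. U i x \<bullet> U j x)" for x
    by (simp add: power2_norm_eq_inner inner_sum_left inner_sum_right inner_commute)
  show "integrable M (\<lambda>x. (norm (\<Sum>j\<in>J. U j x))\<^sup>2)"
    unfolding eq by (intro Bochner_Integration.integrable_sum int)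
  have "(\<integral>x. (norm (\<Sum>j\<in>J. U j x))\<^sup>2 \<partial>M) = (\<Sum>i\<in>J. \<Sum>j\<in>J. \<integral>x. U i x \<bullet> U j x \<partial>M)"
    unfolding eq using int by (simp add: Bochner_Integration.integral_sum Bochner_Integration.integrable_sum)
  also have "\<dots> = (\<Sum>i\<in>J. \<Sum>j\<in>J. if j = i then \<integral>x. (norm (U i x))\<^sup>2 \<partial>M else 0)"
    by (intro sum.cong refl) (auto simp: orth power2_norm_eq_inner)
  finally show "(\<integral>x. (norm (\<Sum>j\<in>J. U j x))\<^sup>2 \<partial>M) = (\<Sum>j\<in>J. \<integral>x. (norm (U j x))\<^sup>2 \<partial>M)"
    using \<open>finite J\<close> by simp
qed

text \<open>The centred terms \<open>U j\<close> are pairwise orthogonal and have second moment at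
  most \<open>\<sigma>\<^sup>2\<close>. The square of their sum therefore integrates to at most
  \<open>card J * \<sigma>\<^sup>2\<close>, and averaging divides this by
  \<open>(card J)\<^sup>2\<close>.\<close>

lemma (in prob_space) minibatch_variance:
  fixes P :: "'z measure" and \<phi> :: "'a \<times> 'z \<Rightarrow> 'b::euclidean_space" and X :: "'i \<Rightarrow> 'a \<Rightarrow> 'z"
  defines "H \<equiv> \<lambda>K. sigma_generated M P X K"
  assumes P: "prob_space P" and ind: "indep_vars (\<lambda>_. P) X I"
    and KJ: "K \<subseteq> I" "J \<subseteq> I" "K \<inter> J = {}" "finite J" "J \<noteq> {}"
    and distr: "\<And>j. j \<in> J \<Longrightarrow> distr M P (X j) = P"
    and \<phi>: "\<phi> \<in> borel_measurable (H K \<Otimes>\<^sub>M P)"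
    and G [measurable]: "G \<in> borel_measurable M"
    and mean: "\<And>j. j \<in> J \<Longrightarrow> AE \<omega> in M. vec_cond_exp M (H K) (\<lambda>\<omega>. \<phi> (\<omega>, X j \<omega>)) \<omega> = G \<omega>"
    and var: "\<And>j. j \<in> J \<Longrightarrow>
      AE \<omega> in M. nn_cond_exp M (H K) (\<lambda>\<omega>. ennreal ((norm (\<phi> (\<omega>, X j \<omega>) - G \<omega>))\<^sup>2)) \<omega> \<le> ennreal (\<sigma>\<^sup>2)"
  shows "integrable M (\<lambda>\<omega>. (norm (G \<omega> - (1 / real (card J)) *\<^sub>R (\<Sum>j\<in>J. \<phi> (\<omega>, X j \<omega>))))\<^sup>2)" (is ?int)
    and "(\<integral>\<omega>. (norm (G \<omega> - (1 / real (card J)) *\<^sub>R (\<Sum>j\<in>J. \<phi> (\<omega>, X j \<omega>))))\<^sup>2 \<partial>M) \<le> \<sigma>\<^sup>2 / real (card J)" (is ?le)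
proof -
  interpret P: prob_space P by (rule P)
  have fresh: "fresh_sample M P X I L j" if "L \<subseteq> I" "j \<in> J" "j \<notin> L" for L j
    using that ind KJ distr by unfold_locales auto
  obtain j0 where j0: "j0 \<in> J" using KJ by auto
  \<comment> \<open>\<open>G\<close> is only measurable with respect to \<open>M\<close>; \<open>V\<close> is its version measurable with respect to
    \<open>H K\<close>.\<close>
  define V where "V = vec_cond_exp M (H K) (\<lambda>\<omega>. \<phi> (\<omega>, X j0 \<omega>))"
  have V: "V \<in> borel_measurable (H K)"
    unfolding V_def vec_cond_exp_def[abs_def] by measurable
  have VG: "AE \<omega> in M. V \<omega> = G \<omega>"
    unfolding V_def by (rule mean[OF j0])
  have sub: "subalgebra M (H K)"
    using fresh_sample.subalgebra_H[OF fresh[of K j0]] KJ j0 by (auto simp: H_def)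
  have [measurable]: "V \<in> borel_measurable M"
    by (rule measurable_from_subalg[OF sub V])
  have idM: "(\<lambda>\<omega>. \<omega>) \<in> measurable M (H K)"
    using sub by (intro measurable_from_subalg[OF _ measurable_ident_sets]) auto
  have X [measurable]: "X j \<in> measurable M P" if "j \<in> J" for j
    using that ind KJ by (auto simp: indep_vars_def)
  have \<phi>X [measurable]: "(\<lambda>\<omega>. \<phi> (\<omega>, X j \<omega>)) \<in> borel_measurable M" if "j \<in> J" for j
    using measurable_compose[OF measurable_Pair[OF idM X[OF that]] \<phi>] .
  define U where "U j \<omega> = \<phi> (\<omega>, X j \<omega>) - V \<omega>" for j \<omega>
  have U_meas: "U j \<in> borel_measurable M" if "j \<in> J" for j
    using \<phi>X[OF that] unfolding U_def[abs_def] by measurable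
  \<comment> \<open>\<open>V\<close> equals \<open>G\<close> almost everywhere, and the conditional
    variance bound is integrated over the whole space, that is, with weight 1 in
    \<open>nn_cond_exp_intg\<close>.\<close>
  have U2: "(\<integral>\<^sup>+\<omega>. ennreal ((norm (U j \<omega>))\<^sup>2) \<partial>M) \<le> ennreal (\<sigma>\<^sup>2)" if j: "j \<in> J" for j
  proof -
    interpret finite_measure_subalgebra M "H K" by unfold_locales (rule sub)
    note [measurable] = \<phi>X[OF j]
    have "(\<integral>\<^sup>+\<omega>. ennreal ((norm (U j \<omega>))\<^sup>2) \<partial>M) = (\<integral>\<^sup>+\<omega>. ennreal ((norm (\<phi> (\<omega>, X j \<omega>) - G \<omega>))\<^sup>2) \<partial>M)"
      using VG by (intro nn_integral_cong_AE) (auto simp: U_def)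
    also have "\<dots> = (\<integral>\<^sup>+\<omega>. nn_cond_exp M (H K) (\<lambda>\<omega>. ennreal ((norm (\<phi> (\<omega>, X j \<omega>) - G \<omega>))\<^sup>2)) \<omega> \<partial>M)"
      using nn_cond_exp_intg[of "\<lambda>_. 1" "\<lambda>\<omega>. ennreal ((norm (\<phi> (\<omega>, X j \<omega>) - G \<omega>))\<^sup>2)"] by simp
    also have "\<dots> \<le> (\<integral>\<^sup>+\<omega>. ennreal (\<sigma>\<^sup>2) \<partial>M)"
      by (intro nn_integral_mono_AE var[OF j])
    finally show ?thesis by (simp add: emeasure_space_1)
  qed
  have U_int: "integrable M (\<lambda>\<omega>. (norm (U j \<omega>))\<^sup>2)" if j: "j \<in> J" for j
    using U2[OF j] U_meas[OF j] by (intro integrableI_bounded) (auto simp: le_less_trans)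
  have U_le: "(\<integral>\<omega>. (norm (U j \<omega>))\<^sup>2 \<partial>M) \<le> \<sigma>\<^sup>2" if j: "j \<in> J" for j
    using U2[OF j] nn_integral_eq_integral[OF U_int[OF j]] by simp
  \<comment> \<open>The claim involves only \<open>P\<close>, \<open>\<phi>\<close> and
    \<open>V\<close>, not a particular sample; deriving it from \<open>j0\<close> thus settles it
    for every index of the batch.\<close>
  have centred: "AE \<omega> in M. integrable P (\<lambda>z. \<phi> (\<omega>, z) - V \<omega>) \<and> (\<integral>z. \<phi> (\<omega>, z) - V \<omega> \<partial>P) = 0"
  proof (rule fresh_sample.centred_fresh[OF fresh[of K j0], folded H_def])
    show "AE \<omega> in M. vec_cond_exp M (H K) (\<lambda>\<omega>. \<phi> (\<omega>, X j0 \<omega>)) \<omega> = V \<omega>"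
      by (simp add: V_def)
    show "(\<integral>\<^sup>+\<omega>. ennreal ((norm (\<phi> (\<omega>, X j0 \<omega>) - V \<omega>))\<^sup>2) \<partial>M) < \<infinity>"
      using U2[OF j0] by (simp add: U_def le_less_trans)
  qed (use KJ j0 \<phi> V in auto)
  have orth: "(\<integral>\<omega>. U i \<omega> \<bullet> U j \<omega> \<partial>M) = 0" if ij: "i \<in> J" "j \<in> J" "i \<noteq> j" for i j
  proof -
    \<comment> \<open>Relative to \<open>K\<close> and \<open>j\<close> together, \<open>U j\<close> is known while \<open>X i\<close> is still fresh.\<close>
    define L where "L = insert j K"
    have KL: "K \<subseteq> L" by (auto simp: L_def)
    have idL [measurable]: "(\<lambda>\<omega>. \<omega>) \<in> measurable (H L) (H K)"
      unfolding H_def by (rule measurable_ident_sigma_generated_mono[OF KL])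
    have [measurable]: "X j \<in> measurable (H L) P"
      unfolding H_def by (rule measurable_sigma_generated) (auto simp: L_def X ij)
    note [measurable] = \<phi> V
    have [measurable]: "V \<in> borel_measurable (H L)"
      by (rule measurable_compose[OF idL V])
    have "(\<lambda>p. \<phi> (fst p, snd p)) \<in> borel_measurable (H L \<Otimes>\<^sub>M P)"
      by (rule measurable_compose[OF measurable_Pair[OF measurable_compose[OF measurable_fst idL] measurable_snd] \<phi>])
    then have [measurable]: "\<phi> \<in> borel_measurable (H L \<Otimes>\<^sub>M P)" by simp
    have W: "(\<lambda>(\<omega>, z). \<phi> (\<omega>, z) - V \<omega>) \<in> borel_measurable (H L \<Otimes>\<^sub>M P)"
      by measurable
    have "(\<integral>\<omega>. (\<lambda>(\<omega>, z). \<phi> (\<omega>, z) - V \<omega>) (\<omega>, X i \<omega>) \<bullet> U j \<omega> \<partial>M) = 0"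
    proof (rule fresh_sample.integral_inner_fresh_zero[OF fresh[of L i], folded H_def])
      show "U j \<in> borel_measurable (H L)"
        unfolding U_def[abs_def]
        by (intro borel_measurable_diff measurable_compose[OF measurable_Pair[OF idL] \<phi>]) measurable
      show "integrable M (\<lambda>\<omega>. (case (\<omega>, X i \<omega>) of (\<omega>, z) \<Rightarrow> \<phi> (\<omega>, z) - V \<omega>) \<bullet> U j \<omega>)"
        using integrable_inner_square[OF U_meas U_meas U_int U_int] ij by (simp add: U_def)
      show "i \<notin> L" "L \<subseteq> I" using KJ ij by (auto simp: L_def)
      show "AE \<omega> in M. integrable P (\<lambda>z. case (\<omega>, z) of (\<omega>, z) \<Rightarrow> \<phi> (\<omega>, z) - V \<omega>) \<and>
          (\<integral>z. (case (\<omega>, z) of (\<omega>, z) \<Rightarrow> \<phi> (\<omega>, z) - V \<omega>) \<partial>P) = 0"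
        using centred by simp
    qed (fact W ij)+
    then show ?thesis by (simp add: U_def)
  qed
  let ?n = "real (card J)"
  have n: "?n > 0" using KJ by (simp add: card_gt_0_iff)
  have sum: "integrable M (\<lambda>\<omega>. (norm (\<Sum>j\<in>J. U j \<omega>))\<^sup>2)"
      "(\<integral>\<omega>. (norm (\<Sum>j\<in>J. U j \<omega>))\<^sup>2 \<partial>M) = (\<Sum>j\<in>J. \<integral>\<omega>. (norm (U j \<omega>))\<^sup>2 \<partial>M)"
    by (rule integral_norm_sum_orthogonal[of J U M]; use KJ(4) U_meas U_int orth in blast)+
  have eq: "AE \<omega> in M. (norm (G \<omega> - (1 / ?n) *\<^sub>R (\<Sum>j\<in>J. \<phi> (\<omega>, X j \<omega>))))\<^sup>2 = (norm (\<Sum>j\<in>J. U j \<omega>))\<^sup>2 / ?n\<^sup>2"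
    using VG
  proof eventually_elim
    case (elim \<omega>)
    have "G \<omega> - (1 / ?n) *\<^sub>R (\<Sum>j\<in>J. \<phi> (\<omega>, X j \<omega>)) = (- 1 / ?n) *\<^sub>R (\<Sum>j\<in>J. U j \<omega>)"
      using n elim by (simp add: U_def sum_subtractf scaleR_diff_right sum_constant_scaleR)
    then show ?case using n by (simp add: power_divide)
  qed
  have [measurable]: "(\<lambda>\<omega>. \<Sum>j\<in>J. \<phi> (\<omega>, X j \<omega>)) \<in> borel_measurable M"
    by (rule borel_measurable_sum) (rule \<phi>X)
  have meas: "(\<lambda>\<omega>. (norm (G \<omega> - (1 / ?n) *\<^sub>R (\<Sum>j\<in>J. \<phi> (\<omega>, X j \<omega>))))\<^sup>2) \<in> borel_measurable M"
    by measurable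
  have meas': "(\<lambda>\<omega>. (norm (\<Sum>j\<in>J. U j \<omega>))\<^sup>2 / ?n\<^sup>2) \<in> borel_measurable M"
    by (rule borel_measurable_integrable, rule integrable_divide, rule sum(1))
  show ?int
    using integrable_cong_AE[OF meas meas' eq] sum(1) by simp
  have "(\<integral>\<omega>. (norm (G \<omega> - (1 / ?n) *\<^sub>R (\<Sum>j\<in>J. \<phi> (\<omega>, X j \<omega>))))\<^sup>2 \<partial>M) = (\<Sum>j\<in>J. \<integral>\<omega>. (norm (U j \<omega>))\<^sup>2 \<partial>M) / ?n\<^sup>2"
    using integral_cong_AE[OF meas meas' eq] sum(2) by simp
  also have "\<dots> \<le> (?n * \<sigma>\<^sup>2) / ?n\<^sup>2"
    using sum_bounded_above[of J "\<lambda>j. \<integral>\<omega>. (norm (U j \<omega>))\<^sup>2 \<partial>M" "\<sigma>\<^sup>2"] U_le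
    by (intro divide_right_mono) auto
  finally show ?le using n by (simp add: power2_eq_square)
qed

subsection \<open>From the step sizes to the bound\<close>

text \<open>The infimum of \<open>c * A + B / c\<close> over positive \<open>c\<close> is
  \<open>2 * sqrt A * sqrt B\<close>; when \<open>A\<close> or \<open>B\<close> is 0 it need not be
  attained, hence the case split.\<close>

lemma le_sqrt_mult_sqrt:
  fixes x A B :: real
  assumes "A \<ge> 0" "B \<ge> 0" and le: "\<And>c. c > 0 \<Longrightarrow> 2 * x \<le> c * A + B / c"
  shows "x \<le> sqrt A * sqrt B"
proof (cases "A > 0 \<and> B > 0")
  case True
  \<comment> \<open>The minimizing weight is \<open>c = sqrt B / sqrt A\<close>.\<close>
  then have "2 * x \<le> sqrt B / sqrt A * A + B / (sqrt B / sqrt A)" by (intro le) simp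
  also have "\<dots> = 2 * (sqrt A * sqrt B)"
    using True real_sqrt_mult_self[of A] real_sqrt_mult_self[of B]
    by (simp add: field_simps flip: power2_eq_square)
  finally show ?thesis by simp
next
  case False
  then consider "A = 0" | "B = 0" using assms by fastforce
  then have "x \<le> 0"
  proof cases
    case 1
    show ?thesis
    proof (rule ccontr)
      assume "\<not> x \<le> 0"
      \<comment> \<open>With \<open>A = 0\<close> a large weight is wanted:
        \<open>c = (B + 1) / x\<close> already makes the remaining term at most \<open>x\<close>.
        For \<open>B = 0\<close> the small weight \<open>x / (A + 1)\<close> does the same
        below.\<close>
      then have "2 * x \<le> B / ((B + 1) / x)" using le[of "(B + 1) / x"] \<open>B \<ge> 0\<close> 1 by simp
      also have "\<dots> \<le> x" using \<open>\<not> x \<le> 0\<close> \<open>B \<ge> 0\<close> by (simp add: field_simps)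
      finally show False using \<open>\<not> x \<le> 0\<close> by simp
    qed
  next
    case 2
    show ?thesis
    proof (rule ccontr)
      assume "\<not> x \<le> 0"
      then have "2 * x \<le> x / (A + 1) * A" using le[of "x / (A + 1)"] \<open>A \<ge> 0\<close> 2 by simp
      also have "\<dots> \<le> x" using \<open>\<not> x \<le> 0\<close> \<open>A \<ge> 0\<close> by (simp add: field_simps)
      finally show False using \<open>\<not> x \<le> 0\<close> by simp
    qed
  qed
  also have "0 \<le> sqrt A * sqrt B" using assms by simp
  finally show ?thesis .
qed

text \<open>Cauchy--Schwarz for the sum and the integral jointly: the weighted Young inequality is
  summed and integrated for each weight \<open>c\<close>, and \<open>le_sqrt_mult_sqrt\<close> then
  optimizes over \<open>c\<close>.\<close>

lemma integral_sum_inner_le_sqrt: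
  fixes f g :: "'i \<Rightarrow> 'a \<Rightarrow> 'b::euclidean_space"
  assumes meas: "\<And>i. i \<in> J \<Longrightarrow> f i \<in> borel_measurable M" "\<And>i. i \<in> J \<Longrightarrow> g i \<in> borel_measurable M"
    and f: "\<And>i. i \<in> J \<Longrightarrow> integrable M (\<lambda>x. (norm (f i x))\<^sup>2)"
    and g: "\<And>i. i \<in> J \<Longrightarrow> integrable M (\<lambda>x. (norm (g i x))\<^sup>2)"
  shows "(\<integral>x. (\<Sum>i\<in>J. f i x \<bullet> g i x) \<partial>M) \<le>
    sqrt (\<integral>x. (\<Sum>i\<in>J. (norm (f i x))\<^sup>2) \<partial>M) * sqrt (\<integral>x. (\<Sum>i\<in>J. (norm (g i x))\<^sup>2) \<partial>M)"
proof (rule le_sqrt_mult_sqrt)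
  fix c :: real assume c: "c > 0"
  have fg: "integrable M (\<lambda>x. \<Sum>i\<in>J. f i x \<bullet> g i x)"
    by (intro Bochner_Integration.integrable_sum integrable_inner_square meas f g)
  have F: "integrable M (\<lambda>x. c * (\<Sum>i\<in>J. (norm (f i x))\<^sup>2))"
    by (intro integrable_mult_right Bochner_Integration.integrable_sum f)
  have G: "integrable M (\<lambda>x. (\<Sum>i\<in>J. (norm (g i x))\<^sup>2) / c)"
    by (intro integrable_divide Bochner_Integration.integrable_sum g)
  have "2 * (u \<bullet> v) \<le> c * (norm u)\<^sup>2 + (norm v)\<^sup>2 / c" for u v :: 'b
  proof -
    \<comment> \<open>Expanding this square and dividing by \<open>c\<close> gives the weighted
      Young inequality.\<close>
    have "0 \<le> (c *\<^sub>R u - v) \<bullet> (c *\<^sub>R u - v) / c" using c by simp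
    then show ?thesis using c
      by (simp add: power2_norm_eq_inner inner_diff_left inner_diff_right inner_commute field_simps)
  qed
  then have "2 * (\<Sum>i\<in>J. f i x \<bullet> g i x) \<le> c * (\<Sum>i\<in>J. (norm (f i x))\<^sup>2) + (\<Sum>i\<in>J. (norm (g i x))\<^sup>2) / c" for x
    by (simp add: sum_distrib_left sum_divide_distrib flip: sum.distrib) (rule sum_mono)
  then have "(\<integral>x. 2 * (\<Sum>i\<in>J. f i x \<bullet> g i x) \<partial>M) \<le>
      (\<integral>x. c * (\<Sum>i\<in>J. (norm (f i x))\<^sup>2) + (\<Sum>i\<in>J. (norm (g i x))\<^sup>2) / c \<partial>M)"
    using fg F G by (intro integral_mono) auto
  then show "2 * (\<integral>x. (\<Sum>i\<in>J. f i x \<bullet> g i x) \<partial>M) \<le>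
      c * (\<integral>x. (\<Sum>i\<in>J. (norm (f i x))\<^sup>2) \<partial>M) + (\<integral>x. (\<Sum>i\<in>J. (norm (g i x))\<^sup>2) \<partial>M) / c"
    using F G by simp
qed (auto intro!: Bochner_Integration.integral_nonneg sum_nonneg)

text \<open>Jensen's inequality via the tangent to \<open>ln\<close> at the mean \<open>m\<close>,
  namely \<open>ln u \<le> ln m + (u / m - 1)\<close>; the lower bound 1 keeps \<open>m\<close> and
  the arguments positive.\<close>

lemma (in prob_space) expectation_ln_le:
  assumes X: "integrable M X" and ln: "integrable M (\<lambda>\<omega>. ln (X \<omega>))"
    and ge: "AE \<omega> in M. (1::real) \<le> X \<omega>"
  shows "expectation (\<lambda>\<omega>. ln (X \<omega>)) \<le> ln (expectation X)"
proof -
  define m where "m = expectation X"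
  have "expectation (\<lambda>_. 1) \<le> m"
    unfolding m_def using X ge by (intro integral_mono_AE) auto
  then have m: "m \<ge> 1" by (simp add: prob_space)
  have "expectation (\<lambda>\<omega>. ln (X \<omega>)) \<le> expectation (\<lambda>\<omega>. ln m + (X \<omega> / m - 1))"
  proof (rule integral_mono_AE)
    show "AE \<omega> in M. ln (X \<omega>) \<le> ln m + (X \<omega> / m - 1)"
      using ge
    proof eventually_elim
      case (elim \<omega>)
      then show ?case using m ln_le_minus_one[of "X \<omega> / m"] by (simp add: ln_div)
    qed
  qed (use X ln in auto)
  also have "\<dots> = ln m" using X m by (simp add: prob_space m_def[symmetric])
  finally show ?thesis by (simp add: m_def)
qed

text \<open>The first bound is the one that telescopes. The other two confine the step size between
  deterministic limits, which later give integrability and a nonnegative logarithm.\<close>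

lemma step_size_growth:
  fixes S S' r \<eta> D :: real
  assumes pos: "S > 0" "S' > 0" "\<eta> > 0" and r: "0 \<le> r" "r \<le> D"
    and step: "S'\<^sup>2 = S\<^sup>2 * (1 + r\<^sup>2 / \<eta>\<^sup>2)"
  shows "r\<^sup>2 \<le> 2 * (\<eta>\<^sup>2 + D\<^sup>2) * (ln S' - ln S)"
    and "S \<le> S'" and "S' \<le> S * sqrt (1 + D\<^sup>2 / \<eta>\<^sup>2)"
proof -
  let ?q = "1 + r\<^sup>2 / \<eta>\<^sup>2"
  have q: "?q \<ge> 1" by simp
  have rD: "r\<^sup>2 \<le> D\<^sup>2" using r by (rule power_mono[rotated])
  have S': "S' = S * sqrt ?q"
    using pos real_sqrt_unique[OF step] by (simp add: real_sqrt_mult)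
  show "S \<le> S'" using pos q mult_left_mono[of 1 "sqrt ?q" S] unfolding S' by simp
  show "S' \<le> S * sqrt (1 + D\<^sup>2 / \<eta>\<^sup>2)"
    using pos rD unfolding S' by (simp add: divide_right_mono)
  \<comment> \<open>The recursion is for squares, so the increment of \<open>ln S\<close> is half of
    \<open>ln ?q\<close>; this is where the factor 2 comes from.\<close>
  have "ln (S * sqrt u) - ln S = ln u / 2" if "u \<ge> 1" for u
    using that pos by (simp add: ln_mult ln_sqrt)
  from this[OF q] have ln_eq: "ln S' - ln S = ln ?q / 2"
    unfolding S' .
  have ln_ge: "1 - 1 / u \<le> ln u" if "u \<ge> 1" for u :: real
    using that ln_le_minus_one[of "1 / u"] by (simp add: ln_div)
  have "r\<^sup>2 / (\<eta>\<^sup>2 + D\<^sup>2) \<le> r\<^sup>2 / (\<eta>\<^sup>2 + r\<^sup>2)"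
    using pos rD by (intro divide_left_mono) (auto intro!: mult_pos_pos add_pos_nonneg)
  also have "\<dots> = 1 - 1 / ?q"
    using pos q by (simp add: field_simps add_pos_nonneg)
  also have "\<dots> \<le> ln ?q"
    by (rule ln_ge[OF q])
  finally have "r\<^sup>2 / (\<eta>\<^sup>2 + D\<^sup>2) \<le> 2 * (ln S' - ln S)"
    unfolding ln_eq by simp
  moreover have "\<eta>\<^sup>2 + D\<^sup>2 > 0" using pos by (simp add: add_pos_nonneg)
  ultimately show "r\<^sup>2 \<le> 2 * (\<eta>\<^sup>2 + D\<^sup>2) * (ln S' - ln S)"
    by (simp only: pos_divide_le_eq mult_ac)
qed

theorem lemma7:
  fixes M :: "'o measure" and P :: "'z measure"
    and l :: "'a::euclidean_space \<Rightarrow> 'z \<Rightarrow> real" and gl :: "'a \<Rightarrow> 'z \<Rightarrow> 'a"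
    and f :: "'a \<Rightarrow> real" and gf :: "'a \<Rightarrow> 'a" and h :: "'a \<Rightarrow> ereal"
    and \<gamma> \<eta> D \<sigma> :: real and b :: "nat \<Rightarrow> nat" and x1 :: 'a
    and \<xi> :: "nat \<Rightarrow> nat \<Rightarrow> 'o \<Rightarrow> 'z"
    and x :: "nat \<Rightarrow> 'o \<Rightarrow> 'a" and S :: "nat \<Rightarrow> 'o \<Rightarrow> real" and t :: nat
  assumes "prob_space M" and "prob_space P"
    \<comment> \<open>the objective\<close>
    and "\<And>y. integrable P (l y)"
    and "\<And>y. f y = (\<integral>z. l y z \<partial>P)"
    and "is_gradient_field f gf"
    and "is_sample_gradient (space P) l gl"
    and "(\<lambda>(y, z). gl y z) \<in> borel_measurable (borel \<Otimes>\<^sub>M P)"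
    and "convex_ereal h" and "proper_ereal h" and "lsc_ereal h"
    and "\<exists>B::real. \<forall>y. ereal B \<le> ereal (f y) + h y"
    \<comment> \<open>the samples and the method\<close>
    and "\<gamma> > 0" and "\<eta> > 0" and "\<And>k. k \<ge> 1 \<Longrightarrow> b k > 0" and "h x1 < \<infinity>"
    and "prob_space.indep_vars M (\<lambda>_. P) (\<lambda>(k, j). \<xi> k j) (SIGMA k:{1..}. {1..b k})"
    and "\<And>k j. k \<ge> 1 \<Longrightarrow> j \<in> {1..b k} \<Longrightarrow> distr M P (\<xi> k j) = P"
    and "\<And>\<omega>. \<omega> \<in> space M \<Longrightarrow>
      adaptive_prox_gradient_run h gl b \<gamma> \<eta> x1 (\<lambda>k j. \<xi> k j \<omega>) (\<lambda>k. x k \<omega>) (\<lambda>k. S k \<omega>)"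
    \<comment> \<open>bounded iterates\<close>
    and "D > 0"
    and "AE \<omega> in M. \<forall>k\<ge>1. norm (x (Suc k) \<omega> - x k \<omega>) \<le> D"
    and "convex_ereal (\<lambda>y. ereal (f y) + h y) \<Longrightarrow>
      \<exists>xs. is_arg_min (\<lambda>y. ereal (f y) + h y) (\<lambda>_. True) xs \<and>
        (AE \<omega> in M. \<forall>k\<ge>1. norm (x k \<omega> - xs) \<le> D)"
    \<comment> \<open>unbiasedness and bounded variance\<close>
    and "\<sigma> > 0"
    and "\<And>k. k \<ge> 1 \<Longrightarrow> (\<lambda>\<omega>. gf (x k \<omega>)) \<in> borel_measurable M"
    and "\<And>k j. k \<ge> 1 \<Longrightarrow> j \<in> {1..b k} \<Longrightarrow>
      AE \<omega> in M. vec_cond_exp M (past_samples M P b \<xi> k)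
        (\<lambda>\<omega>'. gl (x k \<omega>') (\<xi> k j \<omega>')) \<omega> = gf (x k \<omega>)"
    and "\<And>k j. k \<ge> 1 \<Longrightarrow> j \<in> {1..b k} \<Longrightarrow>
      AE \<omega> in M. nn_cond_exp M (past_samples M P b \<xi> k)
        (\<lambda>\<omega>'. ennreal ((norm (gl (x k \<omega>') (\<xi> k j \<omega>') - gf (x k \<omega>')))\<^sup>2)) \<omega> \<le> ennreal (\<sigma>\<^sup>2)"
    and "t \<ge> 1"
  defines "\<delta> \<equiv> \<lambda>k \<omega>. gf (x k \<omega>) - minibatch_gradient gl (b k) (x k \<omega>) (\<lambda>j. \<xi> k j \<omega>)"
  shows "integrable M (\<lambda>\<omega>. \<Sum>k = 1..t. \<delta> k \<omega> \<bullet> (x (Suc k) \<omega> - x k \<omega>)) \<and>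
    integrable M (\<lambda>\<omega>. S (Suc t) \<omega> / \<gamma>) \<and>
    (\<integral>\<omega>. (\<Sum>k = 1..t. \<delta> k \<omega> \<bullet> (x (Suc k) \<omega> - x k \<omega>)) \<partial>M)
      \<le> \<sigma> * sqrt (2 * (\<eta>\<^sup>2 + D\<^sup>2) * (\<Sum>k = 1..t. 1 / real (b k)))
          * sqrt (ln (\<integral>\<omega>. S (Suc t) \<omega> / \<gamma> \<partial>M))"
proof -
  interpret prob_space M by fact
  interpret P: prob_space P by fact
  \<comment> \<open>The double index is flattened, so that all samples form one independent family
    over \<open>I\<close>; \<open>K k\<close> collects the indices used before iteration
    \<open>k\<close>.\<close>
  define X where "X = (\<lambda>(k, j). \<xi> k j)"
  define I where "I = (SIGMA k:{1..}. {1..b k})"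
  define K where "K k = (SIGMA i:{1..<k}. {1..b i})" for k
  define N where "N k = sigma_generated M P X (K k)" for k
  have past: "past_samples M P b \<xi> k = N k" for k
    by (simp add: N_def K_def X_def past_samples_eq)
  have ind: "indep_vars (\<lambda>_. P) X I"
    using assms(16) by (simp add: X_def I_def)
  have KI: "K k \<subseteq> I" for k by (auto simp: K_def I_def)
  have \<xi>: "\<xi> k j \<in> measurable M P" if "k \<ge> 1" "j \<in> {1..b k}" for k j
    using ind that unfolding indep_vars_def X_def I_def by fastforce
  have subN: "subalgebra M (N k)" for k
    unfolding N_def using ind KI by (intro subalgebra_sigma_generated) (auto simp: indep_vars_def)
  have N_Suc: "f \<in> measurable (N (Suc k)) L" if "f \<in> measurable (N k) L"
    for f :: "'o \<Rightarrow> 'l" and L k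
    using that unfolding N_def by (rule measurable_sigma_generated_mono) (auto simp: K_def)
  have \<xi>_N: "\<xi> k j \<in> measurable (N (Suc k)) P" if "k \<ge> 1" "j \<in> {1..b k}" for k j
    using measurable_sigma_generated[of X "(k, j)" M P "K (Suc k)"] \<xi>[OF that] that
    by (simp add: N_def X_def K_def)
  have space_N [simp]: "space (N k) = space M" for k by (simp add: N_def)

  \<comment> \<open>Pathwise properties of the method\<close>
  have x_1: "x 1 \<omega> = x1" and S_1: "S 1 \<omega> = \<gamma>" if "\<omega> \<in> space M" for \<omega>
    using assms(18)[OF that] by (auto simp: adaptive_prox_gradient_run_def)
  have run_min: "is_arg_min (\<lambda>u. ereal (minibatch_gradient gl (b k) (x k \<omega>) (\<lambda>j. \<xi> k j \<omega>) \<bullet> u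
        + S k \<omega> / (2 * \<eta>) * (norm (u - x k \<omega>))\<^sup>2) + h u) (\<lambda>_. True) (x (Suc k) \<omega>)"
    and S_Suc: "(S (Suc k) \<omega>)\<^sup>2 = (S k \<omega>)\<^sup>2 * (1 + (norm (x (Suc k) \<omega> - x k \<omega>))\<^sup>2 / \<eta>\<^sup>2)"
    and S_Suc_pos: "S (Suc k) \<omega> > 0"
    if "\<omega> \<in> space M" "k \<ge> 1" for \<omega> k
    using assms(18)[OF that(1)] that(2) by (auto simp: adaptive_prox_gradient_run_def)
  \<comment> \<open>The method asserts positivity only from index 2 on; at index 1 it comes from
    \<open>\<gamma> > 0\<close>.\<close>
  have S_pos: "S k \<omega> > 0" if "\<omega> \<in> space M" "k \<ge> 1" for \<omega> k
  proof (cases "k = 1")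
    case True
    then show ?thesis using S_1[OF that(1)] \<open>\<gamma> > 0\<close> by simp
  next
    case False
    then show ?thesis using S_Suc_pos[of \<omega> "k - 1"] that by simp
  qed

  \<comment> \<open>Adaptedness of the iterates and step sizes\<close>
  have adapted: "x k \<in> borel_measurable (N k) \<and> S k \<in> borel_measurable (N k)" if "k \<ge> 1" for k
    using that
  proof (induction k rule: nat_induct_at_least)
    case base
    have "x 1 \<in> borel_measurable (N 1) \<longleftrightarrow> (\<lambda>_. x1) \<in> borel_measurable (N 1)"
      by (rule measurable_cong) (simp add: x_1[simplified])
    moreover have "S 1 \<in> borel_measurable (N 1) \<longleftrightarrow> (\<lambda>_. \<gamma>) \<in> borel_measurable (N 1)"
      by (rule measurable_cong) (simp add: S_1[simplified])
    ultimately show ?case by simp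
  next
    case (Suc k)
    have [measurable]: "x k \<in> borel_measurable (N (Suc k))" "S k \<in> borel_measurable (N (Suc k))"
      using Suc.IH by (auto intro: N_Suc)
    have "(\<lambda>\<omega>. gl (x k \<omega>) (\<xi> k j \<omega>)) \<in> borel_measurable (N (Suc k))" if "j \<in> {1..b k}" for j
      using measurable_compose[OF measurable_Pair[OF \<open>x k \<in> borel_measurable (N (Suc k))\<close>
          \<xi>_N[OF Suc.hyps that]] assms(7)] by simp
    then have [measurable]: "(\<lambda>\<omega>. \<Sum>j = 1..b k. gl (x k \<omega>) (\<xi> k j \<omega>)) \<in> borel_measurable (N (Suc k))"
      by (rule borel_measurable_sum)
    have [measurable]: "x (Suc k) \<in> borel_measurable (N (Suc k))"
    proof (rule borel_measurable_prox[OF assms(8,9)])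
      show "(\<lambda>\<omega>. minibatch_gradient gl (b k) (x k \<omega>) (\<lambda>j. \<xi> k j \<omega>)) \<in> borel_measurable (N (Suc k))"
        unfolding minibatch_gradient_def by measurable
      \<comment> \<open>The proximal lemmas weight the quadratic by \<open>s / 2\<close>, the method
        by \<open>S k / (2 * \<eta>)\<close>; hence \<open>s = S k / \<eta>\<close>.\<close>
      show "(\<lambda>\<omega>. S k \<omega> / \<eta>) \<in> borel_measurable (N (Suc k))" by measurable
      show "x k \<in> borel_measurable (N (Suc k))" by fact
      fix \<omega> assume "\<omega> \<in> space (N (Suc k))"
      then have \<omega>: "\<omega> \<in> space M" by simp
      show "S k \<omega> / \<eta> > 0" using S_pos[OF \<omega> Suc.hyps] \<open>\<eta> > 0\<close> by simp
      show "is_arg_min (\<lambda>u. ereal (minibatch_gradient gl (b k) (x k \<omega>) (\<lambda>j. \<xi> k j \<omega>) \<bullet> u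
          + S k \<omega> / \<eta> / 2 * (norm (u - x k \<omega>))\<^sup>2) + h u) (\<lambda>_. True) (x (Suc k) \<omega>)"
        using run_min[OF \<omega> Suc.hyps] by (simp add: mult.commute[of 2])
    qed
    \<comment> \<open>Positivity selects the root of the squared recursion, which exhibits
      \<open>S (Suc k)\<close> as a measurable expression.\<close>
    have "S (Suc k) \<omega> = sqrt ((S k \<omega>)\<^sup>2 * (1 + (norm (x (Suc k) \<omega> - x k \<omega>))\<^sup>2 / \<eta>\<^sup>2))"
      if "\<omega> \<in> space (N (Suc k))" for \<omega>
      using S_Suc[of \<omega> k] S_Suc_pos[of \<omega> k] Suc.hyps that real_sqrt_unique[of "S (Suc k) \<omega>"] by simp
    then have "S (Suc k) \<in> borel_measurable (N (Suc k)) \<longleftrightarrow>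
        (\<lambda>\<omega>. sqrt ((S k \<omega>)\<^sup>2 * (1 + (norm (x (Suc k) \<omega> - x k \<omega>))\<^sup>2 / \<eta>\<^sup>2))) \<in> borel_measurable (N (Suc k))"
      by (rule measurable_cong)
    then show ?case by simp
  qed
  have x_meas [measurable]: "x k \<in> borel_measurable M" and S_meas [measurable]: "S k \<in> borel_measurable M"
    if "k \<ge> 1" for k
    using adapted[OF that] measurable_from_subalg[OF subN] by blast+

  \<comment> \<open>Second moment of the gradient error\<close>
  have \<delta>_sq: "integrable M (\<lambda>\<omega>. (norm (\<delta> k \<omega>))\<^sup>2)"
    and \<delta>_le: "(\<integral>\<omega>. (norm (\<delta> k \<omega>))\<^sup>2 \<partial>M) \<le> \<sigma>\<^sup>2 / real (b k)"
    if k: "k \<ge> 1" for k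
  proof -
    define \<phi> where "\<phi> = (\<lambda>(\<omega>, z). gl (x k \<omega>) z)"
    \<comment> \<open>The flattened indices of batch \<open>k\<close>, disjoint from the past
      \<open>K k\<close>.\<close>
    define J where "J = Pair k ` {1..b k}"
    have card: "card J = b k" by (simp add: J_def card_image inj_on_def)
    have sum: "(\<Sum>j\<in>J. \<phi> (\<omega>, X j \<omega>)) = (\<Sum>j = 1..b k. gl (x k \<omega>) (\<xi> k j \<omega>))" for \<omega>
      by (simp add: J_def sum.reindex inj_on_def \<phi>_def X_def)
    have \<delta>: "\<delta> k \<omega> = gf (x k \<omega>) - (1 / real (card J)) *\<^sub>R (\<Sum>j\<in>J. \<phi> (\<omega>, X j \<omega>))" for \<omega>
      unfolding \<delta>_def minibatch_gradient_def card sum ..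
    have "(\<lambda>p. (\<lambda>(y, z). gl y z) (x k (fst p), snd p)) \<in> borel_measurable (N k \<Otimes>\<^sub>M P)"
      by (rule measurable_compose[OF measurable_Pair[OF measurable_compose[OF measurable_fst] measurable_snd] assms(7)])
        (use adapted[OF k] in simp)
    then have \<phi>: "\<phi> \<in> borel_measurable (N k \<Otimes>\<^sub>M P)"
      by (simp add: \<phi>_def split_beta)
    have J: "J \<subseteq> I" "K k \<inter> J = {}" "finite J" "J \<noteq> {}"
      using k assms(14)[OF k] by (auto simp: J_def I_def K_def)
    have distr_X: "distr M P (X j) = P" if "j \<in> J" for j
      using that assms(17)[OF k] by (auto simp: J_def X_def)
    have mean: "AE \<omega> in M. vec_cond_exp M (N k) (\<lambda>\<omega>. \<phi> (\<omega>, X j \<omega>)) \<omega> = gf (x k \<omega>)"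
      and var: "AE \<omega> in M. nn_cond_exp M (N k)
        (\<lambda>\<omega>. ennreal ((norm (\<phi> (\<omega>, X j \<omega>) - gf (x k \<omega>)))\<^sup>2)) \<omega> \<le> ennreal (\<sigma>\<^sup>2)" if "j \<in> J" for j
      using that assms(24,25)[OF k, of "snd j", unfolded past] by (auto simp: J_def X_def \<phi>_def)
    note batch = minibatch_variance[OF \<open>prob_space P\<close> ind KI J distr_X \<phi>[unfolded N_def] assms(23)[OF k]
        mean[unfolded N_def] var[unfolded N_def]]
    show "integrable M (\<lambda>\<omega>. (norm (\<delta> k \<omega>))\<^sup>2)" unfolding \<delta> by (rule batch(1))
    show "(\<integral>\<omega>. (norm (\<delta> k \<omega>))\<^sup>2 \<partial>M) \<le> \<sigma>\<^sup>2 / real (b k)"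
      using batch(2) unfolding \<delta> card .
  qed
  have \<delta>_meas: "\<delta> k \<in> borel_measurable M" if k: "k \<ge> 1" for k
  proof -
    have "(\<lambda>\<omega>. gl (x k \<omega>) (\<xi> k j \<omega>)) \<in> borel_measurable M" if "j \<in> {1..b k}" for j
      using measurable_compose[OF measurable_Pair[OF x_meas[OF k] \<xi>[OF k that]] assms(7)] by simp
    then have [measurable]: "(\<lambda>\<omega>. \<Sum>j = 1..b k. gl (x k \<omega>) (\<xi> k j \<omega>)) \<in> borel_measurable M"
      by (rule borel_measurable_sum)
    note [measurable] = assms(23)[OF k]
    show ?thesis unfolding \<delta>_def minibatch_gradient_def by measurable
  qed

  \<comment> \<open>Total movement against the growth of the step sizes\<close>
  define r where "r k \<omega> = x (Suc k) \<omega> - x k \<omega>" for k \<omega>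
  have r_meas: "r k \<in> borel_measurable M" if "k \<ge> 1" for k
    using x_meas[of k] x_meas[of "Suc k"] that unfolding r_def[abs_def] by simp
  have r_bound: "AE \<omega> in M. \<forall>k\<ge>1. norm (r k \<omega>) \<le> D"
    using assms(20) by (simp add: r_def)
  have r_sq: "integrable M (\<lambda>\<omega>. (norm (r k \<omega>))\<^sup>2)" if k: "k \<ge> 1" for k
  proof (rule integrable_const_bound[where B = "D\<^sup>2"])
    show "AE \<omega> in M. norm ((norm (r k \<omega>))\<^sup>2) \<le> D\<^sup>2"
      using r_bound by eventually_elim (use k in \<open>simp add: power_mono\<close>)
    show "(\<lambda>\<omega>. (norm (r k \<omega>))\<^sup>2) \<in> borel_measurable M" using r_meas[OF k] by measurable
  qed

  \<comment> \<open>The largest factor by which one step can increase \<open>S\<close> when the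
    movement is at most \<open>D\<close>.\<close>
  define Q where "Q = sqrt (1 + D\<^sup>2 / \<eta>\<^sup>2)"
  \<comment> \<open>The induction on \<open>n\<close> runs along a fixed trajectory, outside the
    null set of \<open>r_bound\<close>. It starts from \<open>S 1 = \<gamma>\<close>, and the
    logarithmic increments telescope.\<close>
  have "AE \<omega> in M. (\<Sum>k = 1..n. (norm (r k \<omega>))\<^sup>2) \<le> 2 * (\<eta>\<^sup>2 + D\<^sup>2) * ln (S (Suc n) \<omega> / \<gamma>)
      \<and> \<gamma> \<le> S (Suc n) \<omega> \<and> S (Suc n) \<omega> \<le> \<gamma> * Q ^ n" for n
    using r_bound AE_space
  proof eventually_elim
    case (elim \<omega>)
    show ?case
    proof (induction n)
      case 0
      show ?case using S_1[OF elim(2)] \<open>\<gamma> > 0\<close> by simp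
    next
      case (Suc n)
      let ?k = "Suc n"
      have step: "(S (Suc ?k) \<omega>)\<^sup>2 = (S ?k \<omega>)\<^sup>2 * (1 + (norm (r ?k \<omega>))\<^sup>2 / \<eta>\<^sup>2)"
        using S_Suc[OF elim(2), of ?k] by (simp add: r_def)
      have pos: "S ?k \<omega> > 0" "S (Suc ?k) \<omega> > 0" using S_pos[OF elim(2)] by auto
      have "norm (r ?k \<omega>) \<le> D" using elim(1) by simp
      note growth = step_size_growth[OF pos \<open>\<eta> > 0\<close> norm_ge_zero this step]
      have "(\<Sum>k = 1..?k. (norm (r k \<omega>))\<^sup>2) \<le> 2 * (\<eta>\<^sup>2 + D\<^sup>2) * (ln (S ?k \<omega> / \<gamma>) + (ln (S (Suc ?k) \<omega>) - ln (S ?k \<omega>)))"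
        using Suc.IH growth(1) by (simp add: distrib_left)
      also have "ln (S ?k \<omega> / \<gamma>) + (ln (S (Suc ?k) \<omega>) - ln (S ?k \<omega>)) = ln (S (Suc ?k) \<omega> / \<gamma>)"
        using pos \<open>\<gamma> > 0\<close> by (simp add: ln_div)
      finally have 1: "(\<Sum>k = 1..?k. (norm (r k \<omega>))\<^sup>2) \<le> 2 * (\<eta>\<^sup>2 + D\<^sup>2) * ln (S (Suc ?k) \<omega> / \<gamma>)" .
      have "S (Suc ?k) \<omega> \<le> S ?k \<omega> * Q" using growth(3) by (simp add: Q_def)
      also have "\<dots> \<le> \<gamma> * Q ^ n * Q"
        using Suc.IH by (intro mult_right_mono) (auto simp: Q_def)
      finally show ?case using 1 Suc.IH growth(2) by (simp add: mult.assoc mult.commute[of Q])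
    qed
  qed
  note path = this[of t]
  define Y where "Y \<omega> = S (Suc t) \<omega> / \<gamma>" for \<omega>
  have Y_meas [measurable]: "Y \<in> borel_measurable M"
    unfolding Y_def[abs_def] by measurable
  \<comment> \<open>These deterministic bounds make both \<open>Y\<close> and \<open>ln Y\<close>
    integrable.\<close>
  have Y_bound: "AE \<omega> in M. 1 \<le> Y \<omega> \<and> Y \<omega> \<le> Q ^ t"
    using path by eventually_elim (use \<open>\<gamma> > 0\<close> in \<open>simp add: Y_def field_simps\<close>)
  have Y_int: "integrable M Y"
    by (rule integrable_const_bound[where B = "Q ^ t"]) (use Y_bound in \<open>auto elim: eventually_mono\<close>)
  have lnY_int: "integrable M (\<lambda>\<omega>. ln (Y \<omega>))"
  proof (rule integrable_const_bound[where B = "Q ^ t"])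
    show "AE \<omega> in M. norm (ln (Y \<omega>)) \<le> Q ^ t"
      using Y_bound
    proof eventually_elim
      case (elim \<omega>)
      then show ?case using ln_bound[of "Y \<omega>"] by (simp add: ln_ge_zero)
    qed
  qed measurable

  \<comment> \<open>Cauchy--Schwarz, variance bound and Jensen combined\<close>
  have inner_int: "integrable M (\<lambda>\<omega>. \<Sum>k = 1..t. \<delta> k \<omega> \<bullet> r k \<omega>)"
    by (intro Bochner_Integration.integrable_sum integrable_inner_square \<delta>_meas r_meas \<delta>_sq r_sq) auto
  have "(\<integral>\<omega>. (\<Sum>k = 1..t. \<delta> k \<omega> \<bullet> r k \<omega>) \<partial>M) \<le>
      sqrt (\<integral>\<omega>. (\<Sum>k = 1..t. (norm (\<delta> k \<omega>))\<^sup>2) \<partial>M) * sqrt (\<integral>\<omega>. (\<Sum>k = 1..t. (norm (r k \<omega>))\<^sup>2) \<partial>M)"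
    by (intro integral_sum_inner_le_sqrt \<delta>_meas r_meas \<delta>_sq r_sq) auto
  also have "\<dots> \<le> sqrt (\<sigma>\<^sup>2 * (\<Sum>k = 1..t. 1 / real (b k))) * sqrt (2 * (\<eta>\<^sup>2 + D\<^sup>2) * ln (expectation Y))"
  proof (intro mult_mono real_sqrt_le_mono)
    have "(\<integral>\<omega>. (\<Sum>k = 1..t. (norm (\<delta> k \<omega>))\<^sup>2) \<partial>M) = (\<Sum>k = 1..t. \<integral>\<omega>. (norm (\<delta> k \<omega>))\<^sup>2 \<partial>M)"
      by (intro Bochner_Integration.integral_sum \<delta>_sq) auto
    also have "\<dots> \<le> (\<Sum>k = 1..t. \<sigma>\<^sup>2 / real (b k))"
      by (intro sum_mono \<delta>_le) auto
    finally show "(\<integral>\<omega>. (\<Sum>k = 1..t. (norm (\<delta> k \<omega>))\<^sup>2) \<partial>M) \<le> \<sigma>\<^sup>2 * (\<Sum>k = 1..t. 1 / real (b k))"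
      by (simp add: sum_distrib_left)
    have "(\<integral>\<omega>. (\<Sum>k = 1..t. (norm (r k \<omega>))\<^sup>2) \<partial>M) \<le> (\<integral>\<omega>. 2 * (\<eta>\<^sup>2 + D\<^sup>2) * ln (Y \<omega>) \<partial>M)"
    proof (rule integral_mono_AE)
      show "integrable M (\<lambda>\<omega>. \<Sum>k = 1..t. (norm (r k \<omega>))\<^sup>2)"
        by (intro Bochner_Integration.integrable_sum r_sq) auto
      show "integrable M (\<lambda>\<omega>. 2 * (\<eta>\<^sup>2 + D\<^sup>2) * ln (Y \<omega>))"
        using lnY_int by (rule integrable_mult_right)
      show "AE \<omega> in M. (\<Sum>k = 1..t. (norm (r k \<omega>))\<^sup>2) \<le> 2 * (\<eta>\<^sup>2 + D\<^sup>2) * ln (Y \<omega>)"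
        using path by eventually_elim (simp add: Y_def)
    qed
    also have "\<dots> = 2 * (\<eta>\<^sup>2 + D\<^sup>2) * expectation (\<lambda>\<omega>. ln (Y \<omega>))" by simp
    also have "\<dots> \<le> 2 * (\<eta>\<^sup>2 + D\<^sup>2) * ln (expectation Y)"
      using Y_bound by (intro mult_left_mono expectation_ln_le Y_int lnY_int) (auto elim: eventually_mono)
    finally show "(\<integral>\<omega>. (\<Sum>k = 1..t. (norm (r k \<omega>))\<^sup>2) \<partial>M) \<le> 2 * (\<eta>\<^sup>2 + D\<^sup>2) * ln (expectation Y)" .
  qed (auto intro!: Bochner_Integration.integral_nonneg sum_nonneg mult_nonneg_nonneg)
  also have "\<dots> = \<sigma> * sqrt (2 * (\<eta>\<^sup>2 + D\<^sup>2) * (\<Sum>k = 1..t. 1 / real (b k))) * sqrt (ln (expectation Y))"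
    using \<open>\<sigma> > 0\<close> by (simp add: real_sqrt_mult)
  finally show ?thesis
    using inner_int Y_int by (simp add: r_def Y_def[abs_def])
qed

end
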